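(* Let $N\geq 2$, and let $a>0$, $\gamma>1$, $\rho_0\ge 0$, $k$, $\mu$, $\lambda$ be real constants with $\mu>0$ and $\lambda+\mu>0$. (i) (Navier-Stokes-Poisson equations) Suppose $k\neq 0$ and $(\rho,v,\Phi)$, with $\rho:\mathbb{R}^N\to[0,\infty)$, $v:\mathbb{R}^N\to\mathbb{R}^N$, $\Phi:\mathbb{R}^N\to\mathbb{R}$, is a smooth solution on $\mathbb{R}^N$ of the system $$\mathrm{div}(\rho v)=0,$$ $$\mathrm{div}(\rho v\otimes v)=-\nabla p+k\rho\nabla\Phi+\mu\Delta v+(\mu+\lambda)\nabla\,\mathrm{div}\,v,$$ $$\Delta\Phi=\rho-\rho_0,\qquad p=a\rho^\gamma,$$ satisfying $$\|\rho\|_{L^\infty}+\|\Phi\|_{L^\infty}+\|\nabla v\|_{L^2}+\|v\|_{L^{\frac{N}{N-1}}}<\infty,$$ and, if $N\geq 7$, satisfying in addition $v\in L^{\frac{3N}{N-1}}(\mathbb{R}^N)$. Then $v=0$ on $\mathbb{R}^N$, and the functions $\Phi$ and $\rho$ are determined by solving the system (that is, they satisfy) $$\rho\nabla\Phi=\frac{a}{k}\nabla\rho^\gamma,\qquad \Delta\Phi=\rho-\rho_0 \quad\text{on } \mathbb{R}^N.$$ (ii) (Navier-Stokes equations) Suppose $(\rho,v)$, with $\rho:\mathbb{R}^N\to[0,\infty)$, $v:\mathbb{R}^N\to\mathbb{R}^N$, is a smooth solution on $\mathbb{R}^N$ of the system $$\mathrm{div}(\rho v)=0,$$ $$\mathrm{div}(\rho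 v\otimes v)=-\nabla p+\mu\Delta v+(\mu+\lambda)\nabla\,\mathrm{div}\,v,\qquad p=a\rho^\gamma,$$ satisfying $$\|\rho\|_{L^\infty}+\|\nabla v\|_{L^2}+\|v\|_{L^{\frac{N}{N-1}}}<\infty,$$ and, if $N\geq 7$, satisfying in addition $v\in L^{\frac{3N}{N-1}}(\mathbb{R}^N)$. Then $v=0$ and $\rho$ is constant on $\mathbb{R}^N$.
   Context: All norms $\|\cdot\|_{L^q}$ are over $\mathbb{R}^N$ with Lebesgue measure. For a density $\rho$ and velocity $v=(v_1,\dots,v_N)$, $\mathrm{div}(\rho v\otimes v)$ is the vector field with $i$-th component $\sum_{j=1}^N\partial_j(\rho v_j v_i)$, and $\nabla v$ is the matrix of first partial derivatives of $v$. Here $\rho$ is the density, $v$ the velocity, $\Phi$ the potential of the underlying force, $p$ the pressure, $\rho_0$ the constant background state, $\mu,\lambda$ the viscosity constants, and $k$ a constant measuring the forcing (repulsive if $k>0$, attractive if $k<0$). *)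

theory Defs
  imports "HOL-Analysis.Analysis" "HOL-Probability.Essential_Supremum"
begin

section \<open>Differential operators on Euclidean space\<close>

definition partial :: "'n::finite \<Rightarrow> (real^'n \<Rightarrow> 'b::real_normed_vector) \<Rightarrow> real^'n \<Rightarrow> 'b" where
  "partial i f x = frechet_derivative f (at x) (axis i 1)"

definition grad :: "(real^'n::finite \<Rightarrow> real) \<Rightarrow> real^'n \<Rightarrow> real^'n" where
  "grad f x = (\<chi> i. partial i f x)"

definition divergence :: "(real^'n::finite \<Rightarrow> real^'n) \<Rightarrow> real^'n \<Rightarrow> real" where
  "divergence u x = (\<Sum>i\<in>UNIV. partial i (\<lambda>y. u y $ i) x)"

definition laplacian :: "(real^'n::finite \<Rightarrow> 'b::real_normed_vector) \<Rightarrow> real^'n \<Rightarrow> 'b" where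
  "laplacian f x = (\<Sum>i\<in>UNIV. partial i (partial i f) x)"

text \<open>The vector field \<open>div (\<rho> v \<otimes> v)\<close>.\<close>

definition div_flux :: "(real^'n::finite \<Rightarrow> real) \<Rightarrow> (real^'n \<Rightarrow> real^'n) \<Rightarrow> real^'n \<Rightarrow> real^'n" where
  "div_flux \<rho> v x = (\<chi> i. \<Sum>j\<in>UNIV. partial j (\<lambda>y. \<rho> y * v y $ j * v y $ i) x)"

primrec Ck :: "nat \<Rightarrow> (real^'n::finite \<Rightarrow> 'b::real_normed_vector) \<Rightarrow> bool" where
  "Ck 0 f \<longleftrightarrow> continuous_on UNIV f"
| "Ck (Suc k) f \<longleftrightarrow> f differentiable_on UNIV \<and> (\<forall>i. Ck k (partial i f))"

definition smooth :: "(real^'n::finite \<Rightarrow> 'b::real_normed_vector) \<Rightarrow> bool" where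
  "smooth f \<longleftrightarrow> (\<forall>k. Ck k f)"

section \<open>Lebesgue norms\<close>

text \<open>For a matrix-valued \<open>f\<close>, \<open>norm (f x)\<close> is the Frobenius norm.  The library has no real
  powers on \<^typ>\<open>ennreal\<close>, hence the case distinction.\<close>

definition Lq_norm :: "real \<Rightarrow> ('a::euclidean_space \<Rightarrow> 'b::real_normed_vector) \<Rightarrow> ennreal" where
  "Lq_norm q f =
    (let I = \<integral>\<^sup>+x. ennreal (norm (f x) powr q) \<partial>lebesgue
     in if I = \<infinity> then \<infinity> else ennreal (enn2real I powr (1 / q)))"

definition Linf_norm :: "('a::euclidean_space \<Rightarrow> 'b::real_normed_vector) \<Rightarrow> ennreal" where
  "Linf_norm f = esssup lebesgue (\<lambda>x. ennreal (norm (f x)))"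

definition Lq_space :: "real \<Rightarrow> ('a::euclidean_space \<Rightarrow> 'b::real_normed_vector) set" where
  "Lq_space q = {f. f \<in> borel_measurable lebesgue \<and> Lq_norm q f < \<infinity>}"

section \<open>The stationary systems\<close>

text \<open>The density may vanish.  Since \<open>\<gamma> > 1\<close> and \<open>\<rho> \<ge> 0\<close> is smooth, the pressure is
  differentiable everywhere, also at zeros of \<open>\<rho>\<close> (where \<open>0 powr \<gamma> = 0\<close>); it need not be smooth
  there and is not required to be.\<close>

definition pressure :: "real \<Rightarrow> real \<Rightarrow> (real^'n::finite \<Rightarrow> real) \<Rightarrow> real^'n \<Rightarrow> real" where
  "pressure a \<gamma> \<rho> x = a * \<rho> x powr \<gamma>"

definition smooth_NSP_solution ::
  "real \<Rightarrow> real \<Rightarrow> real \<Rightarrow> real \<Rightarrow> real \<Rightarrow> real \<Rightarrow>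
   (real^'n::finite \<Rightarrow> real) \<Rightarrow> (real^'n \<Rightarrow> real^'n) \<Rightarrow> (real^'n \<Rightarrow> real) \<Rightarrow> bool" where
  "smooth_NSP_solution a \<gamma> \<rho>\<^sub>0 k \<mu> lam \<rho> v \<Phi> \<longleftrightarrow>
     smooth \<rho> \<and> smooth v \<and> smooth \<Phi> \<and> (\<forall>x. \<rho> x \<ge> 0) \<and>
     (\<forall>x. divergence (\<lambda>y. \<rho> y *\<^sub>R v y) x = 0) \<and>
     (\<forall>x. div_flux \<rho> v x =
        - grad (pressure a \<gamma> \<rho>) x + (k * \<rho> x) *\<^sub>R grad \<Phi> x
        + \<mu> *\<^sub>R laplacian v x + (\<mu> + lam) *\<^sub>R grad (divergence v) x) \<and>
     (\<forall>x. laplacian \<Phi> x = \<rho> x - \<rho>\<^sub>0)"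

definition smooth_NS_solution ::
  "real \<Rightarrow> real \<Rightarrow> real \<Rightarrow> real \<Rightarrow>
   (real^'n::finite \<Rightarrow> real) \<Rightarrow> (real^'n \<Rightarrow> real^'n) \<Rightarrow> bool" where
  "smooth_NS_solution a \<gamma> \<mu> lam \<rho> v \<longleftrightarrow>
     smooth \<rho> \<and> smooth v \<and> (\<forall>x. \<rho> x \<ge> 0) \<and>
     (\<forall>x. divergence (\<lambda>y. \<rho> y *\<^sub>R v y) x = 0) \<and>
     (\<forall>x. div_flux \<rho> v x =
        - grad (pressure a \<gamma> \<rho>) x
        + \<mu> *\<^sub>R laplacian v x + (\<mu> + lam) *\<^sub>R grad (divergence v) x)"

end

theory Submission
  imports Defs
begin

text \<open>
  Write \<open>N\<close> for the dimension and \<open>q = N / (N - 1)\<close>.  Testing the momentum equation with \<open>v\<close>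
  turns everything except the dissipation into a divergence: on smooth solutions
  \<open>\<mu> |\<nabla>v|\<^sup>2 + (\<mu> + \<lambda>) (div v)\<^sup>2 = div G\<close>
  for an explicit flux \<open>G\<close> (\<open>energy_identity\<close>).  The convection term becomes the flux of
  \<open>\<rho> |v|\<^sup>2 / 2\<close> by conservation of mass.  The pressure term is, up to a constant
  factor, the flux of \<open>\<rho> powr \<gamma>\<close>: mass conservation gives \<open>\<nabla>\<rho> \<cdot> v = - \<rho> div v\<close>, so both \<open>\<nabla>p \<cdot> v\<close> and \<open>div (\<rho> powr \<gamma> v)\<close> are
  multiples of \<open>\<rho> powr \<gamma> div v\<close>.  This form stays \<open>C\<^sup>1\<close> at zeros of the density, where
  \<open>\<rho> powr (\<gamma> - 1)\<close> need not be differentiable.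

  Multiply by a cutoff that lives on the ball of radius \<open>R\<close> and has gradient \<open>O(1 / R)\<close>.  Since
  \<open>\<rho>\<close> and \<open>\<Phi>\<close> are bounded, \<open>|G| \<le> C (|v| + |v|\<^sup>3 + |v|\<^sup>2 + |\<nabla>v|\<^sup>2)\<close> (\<open>flux_bound\<close>), and the
  dissipation vanishes as soon as \<open>1 / R\<close> times the integral of this bound over the ball tends to
  \<open>0\<close>.  For \<open>|v|\<close> itself that is exactly what \<open>v \<in> L\<^sup>q\<close> yields (\<open>average_tendsto_0\<close>).  The other terms are
  harmless once \<open>|v|\<^sup>3\<close> is integrable, because \<open>|v|\<^sup>2\<close> then is integrable by interpolation.  Hence
  \<open>\<nabla>v = 0\<close>, so \<open>v\<close> is a constant in \<open>L\<^sup>q\<close>, which is \<open>0\<close> (\<open>velocity_vanishes\<close>).  What remains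
  of the momentum equation is the balance of pressure and force (\<open>static_balance\<close>).

  Integrability of \<open>|v|\<^sup>3\<close> is where the dimension enters (\<open>cube_integrable\<close>).  For \<open>N \<ge> 7\<close> it is
  interpolation between \<open>L\<^sup>q\<close> and the additional hypothesis, whose exponent \<open>3 N / (N - 1)\<close>
  exceeds \<open>3\<close>.  For \<open>N \<le> 6\<close> it follows from \<open>\<nabla>v \<in> L\<^sup>2\<close>, because \<open>3\<close> does not exceed the Sobolev exponent
  \<open>2 N / (N - 2)\<close>, which is infinite for \<open>N = 2\<close>; dimension \<open>6\<close> is critical, so the full Sobolev exponent is
  needed.  The tool is the \<open>L\<^sup>1\<close> inequality of Gagliardo and Nirenberg
  (\<open>Gagliardo_Nirenberg_Sobolev\<close>), applied to \<open>|v|\<close> to the power \<open>5 / 2\<close>, and comes from a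
  purely measure-theoretic statement about integrals along coordinate lines
  (\<open>grid_lines_inequality\<close>).
\<close>

section \<open>Powers and Hoelder's inequality for several factors\<close>

text \<open>Powers of extended nonnegative reals.  The convention \<open>epow x 0 = 1\<close> covers \<open>x = 0\<close> as well, in
  contrast to \<open>powr\<close>; it makes \<open>epow_add\<close> and Hoelder's inequality hold for zero
  exponents, which occur at the critical exponent of the grid-lines inequality.\<close>

definition epow :: "ennreal \<Rightarrow> real \<Rightarrow> ennreal" where
  "epow x p = (if p = 0 then 1 else if x = \<infinity> then \<infinity> else ennreal (enn2real x powr p))"

lemma epow_0 [simp]: "epow x 0 = 1"
  by (simp add: epow_def)

lemma epow_ennreal: "0 \<le> x \<Longrightarrow> p \<noteq> 0 \<Longrightarrow> epow (ennreal x) p = ennreal (x powr p)"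
  by (simp add: epow_def)

lemma epow_top: "p \<noteq> 0 \<Longrightarrow> epow top p = top"
  by (simp add: epow_def)

lemma epow_zero: "p \<noteq> 0 \<Longrightarrow> epow 0 p = 0"
  by (simp add: epow_def)

lemma epow_1 [simp]: "epow x 1 = x"
  by (cases x) (auto simp: epow_ennreal epow_top)

lemma epow_eq_0_iff: "p \<noteq> 0 \<Longrightarrow> epow x p = 0 \<longleftrightarrow> x = 0"
  by (cases x) (auto simp: epow_ennreal epow_top)

lemma epow_eq_top_iff: "p \<noteq> 0 \<Longrightarrow> epow x p = top \<longleftrightarrow> x = top"
  by (cases x) (auto simp: epow_ennreal epow_top)

lemma epow_less_top: "x < top \<Longrightarrow> epow x p < top"
  using epow_eq_top_iff[of p x] by (cases "p = 0") (auto simp: less_top[symmetric])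

lemma epow_add: "0 \<le> p \<Longrightarrow> 0 \<le> r \<Longrightarrow> epow x (p + r) = epow x p * epow x r"
  by (cases x; cases "p = 0"; cases "r = 0")
     (auto simp: epow_ennreal epow_top powr_add ennreal_mult)

lemma epow_epow: "0 \<le> p \<Longrightarrow> 0 \<le> r \<Longrightarrow> epow (epow x p) r = epow x (p * r)"
  by (cases x; cases "p = 0"; cases "r = 0")
     (auto simp: epow_ennreal epow_top powr_powr epow_def)

lemma epow_mult: "0 < p \<Longrightarrow> epow (x * y) p = epow x p * epow y p"
proof (cases "x = 0 \<or> y = 0")
  case False
  assume "0 < p"
  then show ?thesis using False
    by (cases x; cases y)
       (auto simp: epow_ennreal epow_top powr_mult ennreal_mult[symmetric] ennreal_mult_top ennreal_top_mult powr_eq_0_iff)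
qed (auto simp: epow_zero)

lemma epow_mono: "0 \<le> p \<Longrightarrow> x \<le> y \<Longrightarrow> epow x p \<le> epow y p"
  by (cases x; cases y; cases "p = 0")
     (auto simp: epow_ennreal epow_top top_unique powr_mono2)

lemma epow_prod:
  assumes "0 \<le> p"
  shows "epow x (of_nat (card A) * p) = (\<Prod>i\<in>A. epow x p)"
proof (cases "p = 0")
  case False
  have "epow x (of_nat n * p) = epow x p ^ n" for n
    using assms by (induction n) (auto simp: algebra_simps epow_add)
  then show ?thesis by simp
qed auto

lemma epow_measurable [measurable]:
  assumes [measurable]: "f \<in> borel_measurable M"
  shows "(\<lambda>x. epow (f x) p) \<in> borel_measurable M"
  unfolding epow_def by measurable

lemma weighted_arith_geom_mean:
  fixes x w :: "'i \<Rightarrow> real"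
  assumes "finite J" "\<And>j. j \<in> J \<Longrightarrow> 0 < x j" "\<And>j. j \<in> J \<Longrightarrow> 0 \<le> w j" "(\<Sum>j\<in>J. w j) = 1"
  shows "(\<Prod>j\<in>J. x j powr w j) \<le> (\<Sum>j\<in>J. w j * x j)"
proof -
  have "(\<Prod>j\<in>J. x j powr w j) = exp (\<Sum>j\<in>J. w j *\<^sub>R ln (x j))"
    unfolding powr_def real_scaleR_def exp_sum[OF assms(1)] using assms(2) by (intro prod.cong) force+
  also have "\<dots> \<le> (\<Sum>j\<in>J. w j * exp (ln (x j)))"
    using assms by (intro convex_on_sum[OF _ _ exp_convex]) auto
  also have "\<dots> = (\<Sum>j\<in>J. w j * x j)"
    using assms by simp
  finally show ?thesis .
qed

lemma prod_ennreal_top: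
  fixes f :: "'i \<Rightarrow> ennreal"
  assumes "finite J" "\<And>j. j \<in> J \<Longrightarrow> f j \<noteq> 0" "i \<in> J" "f i = top"
  shows "prod f J = top"
  using assms by (subst prod.remove[of _ i]) (auto simp: ennreal_top_mult)

lemma weighted_arith_geom_mean_ennreal:
  fixes x :: "'i \<Rightarrow> ennreal" and w :: "'i \<Rightarrow> real"
  assumes J: "finite J" "\<And>j. j \<in> J \<Longrightarrow> 0 < w j" "(\<Sum>j\<in>J. w j) = 1"
  shows "(\<Prod>j\<in>J. epow (x j) (w j)) \<le> (\<Sum>j\<in>J. ennreal (w j) * x j)"
proof -
  have wn: "w j \<noteq> 0" "0 \<le> w j" if "j \<in> J" for j using J(2)[OF that] by auto
  consider (z) i where "i \<in> J" "x i = 0" | (t) i where "i \<in> J" "x i = top"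
    | (f) "\<And>j. j \<in> J \<Longrightarrow> x j \<noteq> 0 \<and> x j \<noteq> top" by blast
  then show ?thesis
  proof cases
    case z
    then have eq0: "(\<Prod>j\<in>J. epow (x j) (w j)) = 0"
      using J wn by (intro prod_zero) (auto intro!: bexI[of _ i] simp: epow_zero)
    show ?thesis unfolding eq0 by simp
  next
    case t
    then have "ennreal (w i) * x i = top" using J(2)[of i] by (simp add: ennreal_mult_top)
    then have "(\<Sum>j\<in>J. ennreal (w j) * x j) = top"
      using t J(1) by (subst sum.remove[of _ i]) auto
    then show ?thesis by simp
  next
    case f
    define y where "y j = enn2real (x j)" for j
    have y: "x j = ennreal (y j)" "0 < y j" if "j \<in> J" for j
      using f[OF that] by (auto simp: y_def enn2real_positive_iff less_top zero_less_iff_neq_zero)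
    have "(\<Prod>j\<in>J. epow (x j) (w j)) = (\<Prod>j\<in>J. ennreal (y j powr w j))"
      using y wn by (intro prod.cong) (auto simp: epow_ennreal less_imp_le)
    also have "\<dots> = ennreal (\<Prod>j\<in>J. y j powr w j)"
      by (simp add: prod_ennreal)
    also have "\<dots> \<le> ennreal (\<Sum>j\<in>J. w j * y j)"
      using J y wn by (intro ennreal_leI weighted_arith_geom_mean) auto
    also have "\<dots> = (\<Sum>j\<in>J. ennreal (w j) * x j)"
      using y wn by (subst sum_ennreal[symmetric]) (auto intro!: sum.cong simp: ennreal_mult less_imp_le)
    finally show ?thesis .
  qed
qed

text \<open>Normalise each factor to integral \<open>1\<close> and apply
  the weighted inequality of arithmetic and geometric means under the integral.  The degenerate
  cases are a vanishing integral (then the product vanishes almost everywhere) and an infinite one.\<close>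

lemma nn_integral_Holder_pos:
  fixes g :: "'i \<Rightarrow> 'a \<Rightarrow> ennreal" and w :: "'i \<Rightarrow> real"
  assumes J: "finite J" "\<And>j. j \<in> J \<Longrightarrow> 0 < w j" "(\<Sum>j\<in>J. w j) = 1"
    and g [measurable]: "\<And>j. j \<in> J \<Longrightarrow> g j \<in> borel_measurable M"
  shows "(\<integral>\<^sup>+x. (\<Prod>j\<in>J. epow (g j x) (w j)) \<partial>M) \<le> (\<Prod>j\<in>J. epow (\<integral>\<^sup>+x. g j x \<partial>M) (w j))"
proof -
  define G where "G j = (\<integral>\<^sup>+x. g j x \<partial>M)" for j
  have wn: "w j \<noteq> 0" "0 \<le> w j" if "j \<in> J" for j using J(2)[OF that] by auto
  consider (z) i where "i \<in> J" "G i = 0" | (t) i where "i \<in> J" "G i = top" "\<And>j. j \<in> J \<Longrightarrow> G j \<noteq> 0"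
    | (f) "\<And>j. j \<in> J \<Longrightarrow> G j \<noteq> 0 \<and> G j \<noteq> top" by blast
  then show ?thesis
  proof cases
    case z
    then have "AE x in M. g i x = 0"
      unfolding G_def using g[of i] by (subst (asm) nn_integral_0_iff_AE) auto
    then have "AE x in M. (\<Prod>j\<in>J. epow (g j x) (w j)) = 0"
      by eventually_elim (use J z wn in \<open>auto intro!: prod_zero bexI[of _ i] simp: epow_zero\<close>)
    then have "(\<integral>\<^sup>+x. (\<Prod>j\<in>J. epow (g j x) (w j)) \<partial>M) = 0"
      by (subst nn_integral_0_iff_AE) auto
    then show ?thesis by simp
  next
    case t
    then have "(\<Prod>j\<in>J. epow (G j) (w j)) = top"
      using J wn by (intro prod_ennreal_top[of _ _ i]) (auto simp: epow_top epow_eq_0_iff)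
    then show ?thesis by (simp add: G_def)
  next
    case f
    \<comment> \<open>The normalising factors; the weights then turn the arithmetic mean into the constant 1.\<close>
    define c where "c j = 1 / G j" for j
    have Gr: "\<exists>r>0. G j = ennreal r" if "j \<in> J" for j
      using f[OF that] by (cases "G j") (auto simp: order.order_iff_strict)
    have cG: "c j * G j = 1" if j: "j \<in> J" for j
    proof -
      obtain r where r: "r > 0" "G j = ennreal r" using Gr[OF j] by blast
      have "c j = ennreal (1 / r)" using r by (simp add: c_def divide_ennreal flip: ennreal_1)
      then show ?thesis using r by (simp flip: ennreal_mult)
    qed
    have eq: "(\<Prod>j\<in>J. epow (g j x) (w j)) = (\<Prod>j\<in>J. epow (G j) (w j)) * (\<Prod>j\<in>J. epow (c j * g j x) (w j))" for x
    proof -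
      have "epow (g j x) (w j) = epow (G j) (w j) * epow (c j * g j x) (w j)" if j: "j \<in> J" for j
      proof -
        have "g j x = G j * (c j * g j x)" using cG[OF j] by (simp add: mult.assoc[symmetric] mult.commute)
        then show ?thesis using epow_mult[OF J(2)[OF j]] by metis
      qed
      then show ?thesis by (simp add: prod.distrib[symmetric])
    qed
    have "(\<integral>\<^sup>+x. (\<Prod>j\<in>J. epow (g j x) (w j)) \<partial>M)
        = (\<Prod>j\<in>J. epow (G j) (w j)) * (\<integral>\<^sup>+x. (\<Prod>j\<in>J. epow (c j * g j x) (w j)) \<partial>M)"
      unfolding eq by (rule nn_integral_cmult) measurable
    also have "(\<integral>\<^sup>+x. (\<Prod>j\<in>J. epow (c j * g j x) (w j)) \<partial>M)
        \<le> (\<integral>\<^sup>+x. (\<Sum>j\<in>J. ennreal (w j) * (c j * g j x)) \<partial>M)"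
      by (intro nn_integral_mono weighted_arith_geom_mean_ennreal J)
    also have "\<dots> = (\<Sum>j\<in>J. ennreal (w j) * (c j * G j))"
      unfolding G_def by (subst nn_integral_sum) (auto simp: nn_integral_cmult)
    also have "\<dots> = (\<Sum>j\<in>J. ennreal (w j))"
      using cG by simp
    also have "\<dots> = 1" using J wn by (subst sum_ennreal) auto
    finally show ?thesis by (simp add: G_def mult_left_mono)
  qed
qed

text \<open>Factors with weight \<open>0\<close> equal \<open>1\<close> on both sides and can be dropped.\<close>

lemma nn_integral_Holder:
  fixes g :: "'i \<Rightarrow> 'a \<Rightarrow> ennreal" and w :: "'i \<Rightarrow> real"
  assumes J: "finite J" "\<And>j. j \<in> J \<Longrightarrow> 0 \<le> w j" "(\<Sum>j\<in>J. w j) = 1"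
    and g: "\<And>j. j \<in> J \<Longrightarrow> g j \<in> borel_measurable M"
  shows "(\<integral>\<^sup>+x. (\<Prod>j\<in>J. epow (g j x) (w j)) \<partial>M) \<le> (\<Prod>j\<in>J. epow (\<integral>\<^sup>+x. g j x \<partial>M) (w j))"
proof -
  define K where "K = {j\<in>J. w j \<noteq> 0}"
  have K: "K \<subseteq> J" "\<And>j. j \<in> J - K \<Longrightarrow> w j = 0" by (auto simp: K_def)
  have "(\<Prod>j\<in>J. epow (f j) (w j)) = (\<Prod>j\<in>K. epow (f j) (w j))" for f :: "'i \<Rightarrow> ennreal"
    using J K by (intro prod.mono_neutral_right) auto
  moreover have "(\<Sum>j\<in>K. w j) = 1"
    using J K by (subst sum.mono_neutral_left[of J]) auto
  moreover have "finite K" using J K finite_subset by blast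
  moreover have "0 < w j" if "j \<in> K" for j using that J(2)[of j] by (auto simp: K_def)
  ultimately show ?thesis
    using nn_integral_Holder_pos[of K w g M] g K by auto
qed

lemma nn_integral_Holder2:
  assumes "f \<in> borel_measurable M" "g \<in> borel_measurable M" "0 \<le> t" "t \<le> 1"
  shows "(\<integral>\<^sup>+x. epow (f x) (1 - t) * epow (g x) t \<partial>M)
    \<le> epow (\<integral>\<^sup>+x. f x \<partial>M) (1 - t) * epow (\<integral>\<^sup>+x. g x \<partial>M) t"
  using nn_integral_Holder[of "UNIV::bool set" "\<lambda>b. if b then t else 1 - t" "\<lambda>b. if b then g else f" M] assms
  by (auto simp: UNIV_bool)

section \<open>The grid-lines inequality\<close>

interpretation lborel_PiM: product_sigma_finite "\<lambda>_::'i. lborel :: real measure" ..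

lemma line_integral_measurable:
  fixes f :: "('i \<Rightarrow> real) \<Rightarrow> ennreal"
  assumes [measurable]: "f \<in> borel_measurable (PiM s (\<lambda>_. lborel))" and "j \<in> s"
  shows "(\<lambda>x. \<integral>\<^sup>+t. f (x(j := t)) \<partial>lborel) \<in> borel_measurable (PiM s (\<lambda>_. lborel))"
proof -
  have [measurable]: "(\<lambda>z. (fst z)(j := snd z)) \<in> PiM s (\<lambda>_. lborel) \<Otimes>\<^sub>M lborel \<rightarrow>\<^sub>M PiM s (\<lambda>_. lborel::real measure)"
    using assms(2) by (intro measurable_fun_upd[of _ s]) auto
  show ?thesis by measurable
qed

text \<open>The key to the Sobolev inequality, for a single function and with a free exponent \<open>p\<close>, so that it
  can be proved by induction on the set of coordinates.  Integrate one coordinate \<open>i\<close> first: the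
  line integral in direction \<open>i\<close> is constant on the lines in question and factors out, and
  Hoelder's inequality with weights \<open>1 - m p\<close> for \<open>f\<close> and \<open>p\<close> for the line integrals in the \<open>m\<close> remaining
  directions moves the integral inside.  The result has the same shape, with \<open>f\<close> replaced by its integral over
  coordinate \<open>i\<close>.  For \<open>p = 1 / (card s - 1)\<close> the power of \<open>f\<close> on the left disappears.\<close>

lemma grid_lines_inequality:
  fixes f :: "('i \<Rightarrow> real) \<Rightarrow> ennreal"
  assumes "finite s" "f \<in> borel_measurable (PiM s (\<lambda>_. lborel))" "0 \<le> p" "(real (card s) - 1) * p \<le> 1"
  shows "(\<integral>\<^sup>+x. epow (f x) (1 - (real (card s) - 1) * p) *
            (\<Prod>j\<in>s. epow (\<integral>\<^sup>+t. f (x(j := t)) \<partial>lborel) p) \<partial>PiM s (\<lambda>_. lborel))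
     \<le> epow (\<integral>\<^sup>+x. f x \<partial>PiM s (\<lambda>_. lborel)) (1 + p)"
  using assms
proof (induction s arbitrary: f rule: finite_induct)
  case empty
  then show ?case by (simp add: lborel_PiM.nn_integral_empty)
next
  case (insert i s)
  let ?P = "\<lambda>s. PiM s (\<lambda>_. lborel :: real measure)"
  let ?a = "1 - real (card s) * p"
  note [measurable] = insert.prems(1)
  have [measurable]: "(\<lambda>z. (fst z)(i := snd z)) \<in> ?P s \<Otimes>\<^sub>M lborel \<rightarrow>\<^sub>M ?P (insert i s)"
    by (intro measurable_fun_upd[of _ s]) auto
  have a: "0 \<le> ?a" using insert by simp
  have p: "0 \<le> p" by fact
  define F where "F x = (\<integral>\<^sup>+y. f (x(i := y)) \<partial>lborel)" for x
  have F[measurable]: "F \<in> borel_measurable (?P s)"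
    unfolding F_def by measurable
  have inner: "(\<integral>\<^sup>+y. epow (f (x(i := y))) ?a *
            (\<Prod>j\<in>insert i s. epow (\<integral>\<^sup>+t. f (x(i := y, j := t)) \<partial>lborel) p) \<partial>lborel)
       \<le> epow (F x) (1 - (real (card s) - 1) * p) * (\<Prod>j\<in>s. epow (\<integral>\<^sup>+t. F (x(j := t)) \<partial>lborel) p)"
    if x: "x \<in> space (?P s)" for x
  proof -
    \<comment> \<open>The factors and weights for Hoelder: index i stands for the function itself, the other indices for its line integrals.\<close>
    define g where "g j y = (if j = i then f (x(i := y)) else \<integral>\<^sup>+t. f (x(j := t, i := y)) \<partial>lborel)" for j y
    define w where "w j = (if j = i then ?a else p)" for j
    have xc: "(\<lambda>_. x) \<in> N \<rightarrow>\<^sub>M ?P s" for N :: "'b measure" using x by (rule measurable_const)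
    have m1 [measurable]: "(\<lambda>y. x(i := y)) \<in> lborel \<rightarrow>\<^sub>M ?P (insert i s)"
      by (intro measurable_fun_upd[of _ s] xc) auto
    have m2 [measurable]: "(\<lambda>z. x(j := snd z, i := fst z)) \<in> lborel \<Otimes>\<^sub>M lborel \<rightarrow>\<^sub>M ?P (insert i s)"
      if "j \<in> s" for j
      using that by (intro measurable_fun_upd[of _ s] measurable_fun_upd[of s s] xc) auto
    have m2' [measurable]: "(\<lambda>z. x(j := fst z, i := snd z)) \<in> lborel \<Otimes>\<^sub>M lborel \<rightarrow>\<^sub>M ?P (insert i s)"
      if "j \<in> s" for j
      using that by (intro measurable_fun_upd[of _ s] measurable_fun_upd[of s s] xc) auto
    have gm: "g j \<in> borel_measurable lborel" if "j \<in> insert i s" for j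
      using that insert.hyps unfolding g_def by (cases "j = i") auto
    have swap: "(\<integral>\<^sup>+y. g j y \<partial>lborel) = (\<integral>\<^sup>+t. F (x(j := t)) \<partial>lborel)" if j: "j \<in> s" for j
    proof -
      have ji: "j \<noteq> i" using j insert.hyps by auto
      have "(\<lambda>(y, t). f (x(j := t, i := y))) \<in> borel_measurable (lborel \<Otimes>\<^sub>M lborel)"
        using j unfolding split_beta by measurable
      from lborel_pair.Fubini'[OF this] show ?thesis
        using ji by (simp add: g_def F_def)
    qed
    have "(\<integral>\<^sup>+y. epow (f (x(i := y))) ?a *
            (\<Prod>j\<in>insert i s. epow (\<integral>\<^sup>+t. f (x(i := y, j := t)) \<partial>lborel) p) \<partial>lborel)
        = (\<integral>\<^sup>+y. epow (F x) p * (\<Prod>j\<in>insert i s. epow (g j y) (w j)) \<partial>lborel)"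
    proof (intro nn_integral_cong)
      fix y :: real
      have "(\<Prod>j\<in>s. epow (\<integral>\<^sup>+t. f (x(i := y, j := t)) \<partial>lborel) p) = (\<Prod>j\<in>s. epow (g j y) (w j))"
        using insert.hyps by (intro prod.cong) (auto simp: g_def w_def fun_upd_twist)
      then show "epow (f (x(i := y))) ?a *
            (\<Prod>j\<in>insert i s. epow (\<integral>\<^sup>+t. f (x(i := y, j := t)) \<partial>lborel) p)
          = epow (F x) p * (\<Prod>j\<in>insert i s. epow (g j y) (w j))"
        using insert.hyps by (simp add: F_def g_def w_def ac_simps)
    qed
    also have "\<dots> = epow (F x) p * (\<integral>\<^sup>+y. (\<Prod>j\<in>insert i s. epow (g j y) (w j)) \<partial>lborel)"
      using gm by (intro nn_integral_cmult borel_measurable_prod epow_measurable) auto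
    also have "\<dots> \<le> epow (F x) p * (\<Prod>j\<in>insert i s. epow (\<integral>\<^sup>+y. g j y \<partial>lborel) (w j))"
    proof (intro mult_left_mono nn_integral_Holder gm)
      have "(\<Sum>j\<in>s. w j) = (\<Sum>j\<in>s. p)" using insert.hyps by (intro sum.cong) (auto simp: w_def)
      then show "(\<Sum>j\<in>insert i s. w j) = 1" using insert.hyps by (simp add: w_def)
    qed (use insert.hyps a p in \<open>auto simp: w_def\<close>)
    also have "(\<Prod>j\<in>insert i s. epow (\<integral>\<^sup>+y. g j y \<partial>lborel) (w j))
        = epow (F x) ?a * (\<Prod>j\<in>s. epow (\<integral>\<^sup>+t. F (x(j := t)) \<partial>lborel) p)"
    proof -
      have "(\<Prod>j\<in>s. epow (\<integral>\<^sup>+y. g j y \<partial>lborel) (w j)) = (\<Prod>j\<in>s. epow (\<integral>\<^sup>+t. F (x(j := t)) \<partial>lborel) p)"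
        using insert.hyps swap by (intro prod.cong) (auto simp: w_def)
      then show ?thesis using insert.hyps by (simp add: F_def g_def w_def)
    qed
    also have "epow (F x) p * (epow (F x) ?a * (\<Prod>j\<in>s. epow (\<integral>\<^sup>+t. F (x(j := t)) \<partial>lborel) p))
        = epow (F x) (p + ?a) * (\<Prod>j\<in>s. epow (\<integral>\<^sup>+t. F (x(j := t)) \<partial>lborel) p)"
      using a p by (simp add: epow_add mult.assoc)
    also have "p + ?a = 1 - (real (card s) - 1) * p" by (simp add: algebra_simps)
    finally show ?thesis .
  qed
  have c: "1 - (real (card (insert i s)) - 1) * p = ?a" using insert.hyps by simp
  have [measurable]: "(\<lambda>x. \<integral>\<^sup>+t. f (x(j := t)) \<partial>lborel) \<in> borel_measurable (?P (insert i s))"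
    if "j \<in> insert i s" for j using that by (intro line_integral_measurable insert.prems)
  have "(\<integral>\<^sup>+x. epow (f x) ?a * (\<Prod>j\<in>insert i s. epow (\<integral>\<^sup>+t. f (x(j := t)) \<partial>lborel) p) \<partial>?P (insert i s))
      = (\<integral>\<^sup>+x. \<integral>\<^sup>+y. epow (f (x(i := y))) ?a *
            (\<Prod>j\<in>insert i s. epow (\<integral>\<^sup>+t. f (x(i := y, j := t)) \<partial>lborel) p) \<partial>lborel \<partial>?P s)"
    by (rule lborel_PiM.product_nn_integral_insert[OF insert.hyps]) measurable
  also have "\<dots> \<le> (\<integral>\<^sup>+x. epow (F x) (1 - (real (card s) - 1) * p) *
         (\<Prod>j\<in>s. epow (\<integral>\<^sup>+t. F (x(j := t)) \<partial>lborel) p) \<partial>?P s)"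
    by (intro nn_integral_mono inner)
  also have "\<dots> \<le> epow (\<integral>\<^sup>+x. F x \<partial>?P s) (1 + p)"
    using a p by (intro insert.IH F) (auto simp: algebra_simps)
  also have "(\<integral>\<^sup>+x. F x \<partial>?P s) = (\<integral>\<^sup>+x. f x \<partial>?P (insert i s))"
    unfolding F_def by (rule lborel_PiM.product_nn_integral_insert[symmetric, OF insert.hyps]) measurable
  finally show ?case unfolding c .
qed

section \<open>The Gagliardo--Nirenberg--Sobolev inequality\<close>

lemma vec_lambda_measurable [measurable]:
  "(\<lambda>f. \<chi> i. f i) \<in> PiM UNIV (\<lambda>_::'n::finite. lborel) \<rightarrow>\<^sub>M (borel :: (real^'n) measure)"
  unfolding borel_measurable_euclidean_space[where 'c = "real^'n"]
  by (auto simp: Basis_vec_def inner_axis)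

text \<open>Lebesgue measure as a product over the index type, which makes integration along a
  single coordinate accessible.\<close>

lemma lborel_vec:
  "(lborel :: (real^'n::finite) measure) = distr (PiM UNIV (\<lambda>_::'n. lborel)) borel (\<lambda>f. \<chi> i. f i)"
proof (rule lborel_eqI)
  fix l u :: "real^'n"
  assume le: "\<And>b. b \<in> Basis \<Longrightarrow> l \<bullet> b \<le> u \<bullet> b"
  have le': "l $ i \<le> u $ i" for i
  proof -
    have "axis i (1::real) \<in> Basis" by (auto simp: Basis_vec_def)
    from le[OF this] show ?thesis by (simp add: inner_axis)
  qed
  have "(\<lambda>f. \<chi> i. f i) -` box l u \<inter> space (PiM UNIV (\<lambda>_::'n. lborel)) = PiE UNIV (\<lambda>i. {l $ i <..< u $ i})"
    by (auto simp: mem_box_cart space_PiM PiE_def Pi_iff)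
  then have "emeasure (distr (PiM UNIV (\<lambda>_::'n. lborel)) borel (\<lambda>f. \<chi> i. f i)) (box l u)
      = (\<Prod>i\<in>UNIV. ennreal (u $ i - l $ i))"
    using le' by (simp add: emeasure_distr lborel_PiM.emeasure_PiM)
  also have "\<dots> = ennreal (\<Prod>i\<in>UNIV. u $ i - l $ i)"
    using le' by (simp add: prod_ennreal)
  also have "(\<Prod>i\<in>UNIV. u $ i - l $ i) = (\<Prod>b\<in>Basis. (u - l) \<bullet> b)"
  proof -
    have B: "(Basis :: (real^'n) set) = range (\<lambda>i. axis i 1)" by (auto simp: Basis_vec_def)
    show ?thesis
      unfolding B by (subst prod.reindex) (auto simp: inner_axis inj_on_def axis_eq_axis)
  qed
  finally show "emeasure (distr (PiM UNIV (\<lambda>_::'n. lborel)) borel (\<lambda>f. \<chi> i. f i)) (box l u)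
      = ennreal (\<Prod>b\<in>Basis. (u - l) \<bullet> b)" .
qed simp

lemma nn_integral_lborel_vec:
  assumes "f \<in> borel_measurable (borel :: (real^'n::finite) measure)"
  shows "(\<integral>\<^sup>+x. f x \<partial>lborel) = (\<integral>\<^sup>+x. f (\<chi> i. x i) \<partial>PiM UNIV (\<lambda>_::'n. lborel))"
  by (subst lborel_vec) (rule nn_integral_distr[OF vec_lambda_measurable], use assms in simp)

lemma line_eq:
  "(\<chi> i. (x(j := y)) i) = (\<chi> i. (x(j := 0)) i) + y *\<^sub>R (axis j 1 :: real^'n::finite)"
  by (auto simp: vec_eq_iff axis_def)

lemma continuous_line: "continuous_on UNIV (\<lambda>y. (\<chi> i. (x(j := y)) i) :: real^'n::finite)"
  by (subst line_eq) (intro continuous_intros)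

lemma partial_line:
  fixes F :: "real^'n::finite \<Rightarrow> real"
  assumes "\<And>x. F differentiable (at x)"
  shows "((\<lambda>y. F (\<chi> i. (x(j := y)) i)) has_real_derivative partial j F (\<chi> i. (x(j := y)) i)) (at y)"
proof -
  have 1: "((\<lambda>y. (\<chi> i. (x(j := y)) i)) has_derivative (\<lambda>h. h *\<^sub>R axis j 1)) (at y)"
    by (subst line_eq) (auto intro!: derivative_eq_intros)
  let ?D = "frechet_derivative F (at (\<chi> i. (x(j := y)) i))"
  have D: "(F has_derivative ?D) (at (\<chi> i. (x(j := y)) i))"
    using assms frechet_derivative_works by blast
  have "((\<lambda>y. F (\<chi> i. (x(j := y)) i)) has_derivative (\<lambda>h. ?D (h *\<^sub>R axis j 1))) (at y)"
    using has_derivative_compose[OF 1 D] .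
  moreover have "(\<lambda>h. ?D (h *\<^sub>R axis j 1)) = (*) (partial j F (\<chi> i. (x(j := y)) i))"
    using linear_scale[OF has_derivative_linear[OF D]] by (auto simp: partial_def)
  ultimately show ?thesis by (simp add: has_field_derivative_def)
qed

text \<open>If the total variation were smaller than \<open>|h x|\<close>, then \<open>|h|\<close> would be bounded below by a positive
  constant on the whole line.  Integrability thus replaces the usual assumption of compact support.\<close>

lemma abs_le_nn_integral_deriv:
  fixes h h' :: "real \<Rightarrow> real"
  assumes h: "\<And>y. (h has_real_derivative h' y) (at y)" and h': "continuous_on UNIV h'"
    and fin: "(\<integral>\<^sup>+y. ennreal \<bar>h y\<bar> \<partial>lborel) < top"
  shows "ennreal \<bar>h x\<bar> \<le> (\<integral>\<^sup>+y. ennreal \<bar>h' y\<bar> \<partial>lborel)"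
proof (rule ccontr)
  let ?I = "\<integral>\<^sup>+y. ennreal \<bar>h' y\<bar> \<partial>lborel"
  assume "\<not> ennreal \<bar>h x\<bar> \<le> ?I"
  then have lt: "?I < ennreal \<bar>h x\<bar>" by simp
  then obtain c where c: "?I = ennreal c" "0 \<le> c" by (cases ?I) auto
  then have cx: "c < \<bar>h x\<bar>" using lt by (simp add: ennreal_less_iff)
  have diff: "\<bar>h b - h a\<bar> \<le> c" if "a \<le> b" for a b
  proof -
    have i: "integrable lborel (\<lambda>x. indicator {a..b} x *\<^sub>R h' x)"
      using h' by (intro borel_integrable_compact continuous_on_subset[OF h']) auto
    have "(\<integral>x. indicator {a..b} x *\<^sub>R h' x \<partial>lborel) = h b - h a"
      using that h by (intro integral_FTC_atLeastAtMost continuous_on_subset[OF h'])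
        (auto intro: has_field_derivative_at_within simp flip: has_real_derivative_iff_has_vector_derivative)
    then have "ennreal \<bar>h b - h a\<bar> \<le> (\<integral>\<^sup>+x. norm (indicator {a..b} x *\<^sub>R h' x) \<partial>lborel)"
      using integral_norm_bound_ennreal[OF i] by simp
    also have "\<dots> \<le> ?I"
      by (intro nn_integral_mono ennreal_leI) (auto split: split_indicator)
    finally show ?thesis using c by simp
  qed
  have "\<bar>h x\<bar> - c \<le> \<bar>h y\<bar>" for y
    using diff[of x y] diff[of y x] by (cases "x \<le> y") auto
  then have "(\<integral>\<^sup>+y. ennreal (\<bar>h x\<bar> - c) \<partial>(lborel :: real measure)) \<le> (\<integral>\<^sup>+y. ennreal \<bar>h y\<bar> \<partial>lborel)"
    by (intro nn_integral_mono ennreal_leI)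
  moreover have "(\<integral>\<^sup>+y. ennreal (\<bar>h x\<bar> - c) \<partial>(lborel :: real measure)) = top"
    using cx by (simp add: ennreal_mult_top)
  ultimately show False using fin by (simp add: top_unique)
qed

text \<open>For almost every \<open>x\<close>, \<open>|w x|\<close> is at most the integral of \<open>f\<close> along each coordinate line through \<open>x\<close>; so
  \<open>|w|\<close> to the power \<open>N p = 1 + p\<close> is at most the product of the \<open>N\<close> line integrals to the power \<open>p\<close>,
  which the grid-lines inequality controls.  The pointwise bound comes from the fundamental theorem
  of calculus on each line, and integrability of \<open>w\<close> restricts it to almost every \<open>x\<close>: almost every
  line carries an integrable restriction of \<open>w\<close>.\<close>

theorem Gagliardo_Nirenberg_Sobolev:
  fixes w :: "real^'n::finite \<Rightarrow> real" and f :: "real^'n \<Rightarrow> ennreal"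
  assumes n: "CARD('n) \<ge> 2" and p: "p = 1 / (real CARD('n) - 1)"
    and w: "\<And>x. w differentiable (at x)" "\<And>i. continuous_on UNIV (partial i w)"
    and f [measurable]: "f \<in> borel_measurable borel"
    and bound: "\<And>i x. ennreal \<bar>partial i w x\<bar> \<le> f x"
    and fin: "(\<integral>\<^sup>+x. ennreal \<bar>w x\<bar> \<partial>lborel) < top"
  shows "(\<integral>\<^sup>+x. epow (ennreal \<bar>w x\<bar>) (1 + p) \<partial>lborel) \<le> epow (\<integral>\<^sup>+x. f x \<partial>lborel) (1 + p)"
proof -
  let ?P = "\<lambda>s::'n set. PiM s (\<lambda>_. lborel :: real measure)"
  let ?v = "\<lambda>x. (\<chi> i. x i) :: real^'n"
  have wc: "continuous_on UNIV w"
    using w(1) by (intro differentiable_imp_continuous_on) (auto simp: differentiable_on_def)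
  have [measurable]: "w \<in> borel_measurable borel"
    using wc by (rule borel_measurable_continuous_onI)
  define F where "F j x = (\<integral>\<^sup>+t. f (?v (x(j := t))) \<partial>lborel)" for j x
  have F [measurable]: "F j \<in> borel_measurable (?P UNIV)" for j
    unfolding F_def by (rule line_integral_measurable) auto
  have ae: "AE x in ?P UNIV. ennreal \<bar>w (?v x)\<bar> \<le> F j x" for j
  proof -
    let ?s = "UNIV - {j}"
    have u: "insert j ?s = UNIV" by auto
    have [measurable]: "(\<lambda>z. (fst z)(j := snd z)) \<in> ?P ?s \<Otimes>\<^sub>M lborel \<rightarrow>\<^sub>M ?P UNIV"
      by (intro measurable_fun_upd[of _ ?s]) auto
    \<comment> \<open>The exceptional set. By Fubini it is null, because almost every line in direction j misses it.\<close>
    define S where "S = {x \<in> space (?P UNIV). F j x < ennreal \<bar>w (?v x)\<bar>}"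
    have S [measurable]: "S \<in> sets (?P UNIV)"
      unfolding S_def by (rule borel_measurable_less[OF F]) measurable
    have ins: "integral\<^sup>N (?P UNIV) g = (\<integral>\<^sup>+x. (\<integral>\<^sup>+y. g (x(j := y)) \<partial>lborel) \<partial>?P ?s)"
      if "g \<in> borel_measurable (?P UNIV)" for g
      using lborel_PiM.product_nn_integral_insert[of ?s j g] that by (simp add: u)
    define W where "W x = ennreal \<bar>w (?v x)\<bar>" for x
    have [measurable]: "W \<in> borel_measurable (?P UNIV)"
      unfolding W_def by measurable
    have "(\<integral>\<^sup>+x. (\<integral>\<^sup>+y. W (x(j := y)) \<partial>lborel) \<partial>?P ?s) < top"
      using fin ins[of W] nn_integral_lborel_vec[of "\<lambda>x. ennreal \<bar>w x\<bar>"]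
      by (simp add: W_def[abs_def] del: fun_upd_apply)
    then have "AE x in ?P ?s. (\<integral>\<^sup>+y. W (x(j := y)) \<partial>lborel) \<noteq> \<infinity>"
      by (intro nn_integral_noteq_infinite) auto
    then have "AE x in ?P ?s. (\<integral>\<^sup>+y. indicator S (x(j := y)) \<partial>lborel) = 0"
    proof eventually_elim
      case (elim x)
      have "ennreal \<bar>w (?v (x(j := y)))\<bar> \<le> F j (x(j := y))" for y
      proof -
        have "continuous_on UNIV (\<lambda>y. partial j w (?v (x(j := y))))"
          by (intro continuous_on_compose2[OF w(2)] continuous_line) auto
        from abs_le_nn_integral_deriv[OF partial_line[OF w(1)] this, of y] elim[unfolded W_def]
        have "ennreal \<bar>w (?v (x(j := y)))\<bar> \<le> (\<integral>\<^sup>+y. ennreal \<bar>partial j w (?v (x(j := y)))\<bar> \<partial>lborel)"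
          by (simp add: less_top del: fun_upd_apply)
        also have "\<dots> \<le> F j (x(j := y))"
          unfolding F_def fun_upd_upd by (intro nn_integral_mono bound)
        finally show ?thesis .
      qed
      then show ?case by (simp add: S_def not_less del: fun_upd_apply)
    qed
    then have "(\<integral>\<^sup>+x. (\<integral>\<^sup>+y. indicator S (x(j := y)) \<partial>lborel) \<partial>?P ?s) = 0"
      by (subst nn_integral_0_iff_AE) auto
    then have "(\<integral>\<^sup>+x. indicator S x \<partial>?P UNIV) = 0"
      using ins[OF borel_measurable_indicator[OF S]] by simp
    then have "emeasure (?P UNIV) S = 0"
      by simp
    then show ?thesis by (intro AE_I[of _ _ S]) (auto simp: S_def not_le)
  qed
  have n1: "real CARD('n) - 1 > 0" using n by linarith
  have p0: "0 \<le> p" "p > 0" using n1 p by auto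
  have Np: "real CARD('n) * p = 1 + p" using n1 by (simp add: p field_simps)
  have N1p: "(real CARD('n) - 1) * p = 1" using n1 by (simp add: p)
  have "(\<integral>\<^sup>+x. epow (ennreal \<bar>w x\<bar>) (1 + p) \<partial>lborel) = (\<integral>\<^sup>+x. epow (ennreal \<bar>w (?v x)\<bar>) (1 + p) \<partial>?P UNIV)"
    by (rule nn_integral_lborel_vec) measurable
  also have "\<dots> \<le> (\<integral>\<^sup>+x. (\<Prod>j\<in>UNIV. epow (F j x) p) \<partial>?P UNIV)"
  proof (rule nn_integral_mono_AE)
    have "AE x in ?P UNIV. \<forall>j. ennreal \<bar>w (?v x)\<bar> \<le> F j x"
      using ae by (simp add: AE_all_countable)
    then show "AE x in ?P UNIV. epow (ennreal \<bar>w (?v x)\<bar>) (1 + p) \<le> (\<Prod>j\<in>UNIV. epow (F j x) p)"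
    proof eventually_elim
      case (elim x)
      have "epow (ennreal \<bar>w (?v x)\<bar>) (1 + p) = (\<Prod>j\<in>(UNIV::'n set). epow (ennreal \<bar>w (?v x)\<bar>) p)"
        using epow_prod[OF p0(1), of _ "UNIV::'n set"] Np by simp
      also have "\<dots> \<le> (\<Prod>j\<in>UNIV. epow (F j x) p)"
        using elim p0 by (intro prod_mono_ennreal epow_mono) auto
      finally show ?case .
    qed
  qed
  also have "\<dots> \<le> epow (\<integral>\<^sup>+x. f (?v x) \<partial>?P UNIV) (1 + p)"
    using grid_lines_inequality[of UNIV "\<lambda>x. f (?v x)" p] N1p p0 by (simp add: F_def)
  also have "(\<integral>\<^sup>+x. f (?v x) \<partial>?P UNIV) = (\<integral>\<^sup>+x. f x \<partial>lborel)"
    by (rule nn_integral_lborel_vec[symmetric]) measurable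
  finally show ?thesis .
qed

section \<open>Pointwise calculus\<close>

text \<open>At the origin the difference quotient is bounded by \<open>\<bar>h\<bar> powr (s - 1)\<close>.\<close>

lemma abs_powr_has_derivative_0:
  assumes "s > 1"
  shows "((\<lambda>t::real. \<bar>t\<bar> powr s) has_real_derivative 0) (at 0)"
proof -
  have "((\<lambda>h::real. \<bar>h\<bar> powr (s - 1)) \<longlongrightarrow> \<bar>0\<bar> powr (s - 1)) (at 0)"
    using assms by (intro tendsto_powr' tendsto_intros) auto
  then have l: "((\<lambda>h::real. \<bar>h\<bar> powr (s - 1)) \<longlongrightarrow> 0) (at 0)" using assms by simp
  have "((\<lambda>h::real. (\<bar>0 + h\<bar> powr s - \<bar>0\<bar> powr s) / h) \<longlongrightarrow> 0) (at 0)"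
  proof (rule Lim_null_comparison[OF _ l])
    have "norm ((\<bar>0 + h\<bar> powr s - \<bar>0\<bar> powr s) / h) \<le> \<bar>h\<bar> powr (s - 1)" for h :: real
      by (cases "h = 0") (auto simp: powr_diff)
    then show "\<forall>\<^sub>F h in at 0. norm ((\<bar>0 + h\<bar> powr s - \<bar>0\<bar> powr s) / h) \<le> \<bar>h\<bar> powr (s - 1)"
      by simp
  qed
  then show ?thesis by (simp add: DERIV_def)
qed

text \<open>The chain rule survives at zeros of \<open>f\<close>, since \<open>f\<close> agrees with \<open>\<bar>f\<bar>\<close> and
  \<open>\<bar>t\<bar> powr s\<close> has derivative \<open>0\<close> at the origin.  This covers the pressure at vacuum and the power \<open>5 / 4\<close> of \<open>|v|\<^sup>2\<close> at zeros
  of \<open>v\<close>.\<close>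

lemma has_derivative_powr_nonneg:
  fixes f :: "'a::real_normed_vector \<Rightarrow> real"
  assumes f: "(f has_derivative D) (at x)" and nn: "\<And>y. 0 \<le> f y" and s: "s > 1"
  shows "((\<lambda>y. f y powr s) has_derivative (\<lambda>h. s * f x powr (s - 1) * D h)) (at x)"
proof (cases "f x = 0")
  case True
  have "((\<lambda>y. \<bar>f y\<bar> powr s) has_derivative (\<lambda>h. 0 * D h)) (at x)"
    using has_derivative_compose[OF f, of "\<lambda>t. \<bar>t\<bar> powr s" "(*) 0"] abs_powr_has_derivative_0[OF s] True
    by (simp add: has_field_derivative_def)
  then show ?thesis using nn s True by simp
next
  case False
  then have pos: "f x > 0" using nn[of x] by simp
  have "((\<lambda>t. t powr s) has_derivative (*) (s * f x powr (s - 1))) (at (f x))"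
    using has_real_derivative_powr[OF pos, of s] by (simp add: has_field_derivative_def)
  from has_derivative_compose[OF f this] show ?thesis by simp
qed

lemma partial_eqI: "(f has_derivative D) (at x) \<Longrightarrow> partial i f x = D (axis i 1)"
  using frechet_derivative_at[of f D x] by (simp add: partial_def)

lemma has_derivative_partial:
  "f differentiable (at x) \<Longrightarrow> (f has_derivative frechet_derivative f (at x)) (at x)"
  by (simp add: frechet_derivative_works)

lemma jacobian_component:
  fixes v :: "real^'n::finite \<Rightarrow> real^'m::finite"
  shows "jacobian v (at x) $ i $ j = partial j v x $ i"
  by (simp add: jacobian_def matrix_def partial_def)

lemma norm_partial_le_jacobian:
  fixes v :: "real^'n::finite \<Rightarrow> real^'m::finite"
  shows "norm (partial j v x) \<le> norm (jacobian v (at x))"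
proof -
  have "\<bar>partial j v x $ i\<bar> \<le> norm (jacobian v (at x) $ i)" for i
    using component_le_norm_cart[of "jacobian v (at x) $ i" j] by (simp add: jacobian_component)
  then show ?thesis
    unfolding norm_vec_def[of "partial j v x"] norm_vec_def[of "jacobian v (at x)"]
    by (intro L2_set_mono) auto
qed

lemma continuous_jacobian:
  fixes v :: "real^'n::finite \<Rightarrow> real^'m::finite"
  assumes "\<And>i. continuous_on UNIV (partial i v)"
  shows "continuous_on UNIV (\<lambda>x. jacobian v (at x))"
proof -
  have "jacobian v (at x) = (\<chi> i j. partial j v x $ i)" for x
    by (simp add: vec_eq_iff jacobian_component)
  then show ?thesis
    by (auto intro!: continuous_on_vec_lambda continuous_on_component assms)
qed

lemma has_derivative_0_of_partials:
  fixes f :: "real^'n::finite \<Rightarrow> 'b::real_normed_vector"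
  assumes "f differentiable (at x)" "\<And>i. partial i f x = 0"
  shows "(f has_derivative (\<lambda>_. 0)) (at x)"
proof -
  let ?D = "frechet_derivative f (at x)"
  have D: "(f has_derivative ?D) (at x)" using assms(1) by (rule has_derivative_partial)
  have lin: "linear ?D" using D by (rule has_derivative_linear)
  have "?D h = 0" for h
  proof -
    have "?D h = ?D (\<Sum>i\<in>UNIV. h $ i *\<^sub>R axis i 1)"
      using basis_expansion[of h] by (simp add: scalar_mult_eq_scaleR)
    also have "\<dots> = (\<Sum>i\<in>UNIV. h $ i *\<^sub>R partial i f x)"
      by (simp add: linear_sum[OF lin] linear_scale[OF lin] partial_def)
    finally show ?thesis using assms(2) by simp
  qed
  then have "?D = (\<lambda>_. 0)" by auto
  then show ?thesis using D by simp
qed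

lemma constant_of_partials_0:
  fixes f :: "real^'n::finite \<Rightarrow> 'b::real_normed_vector"
  assumes "\<And>x. f differentiable (at x)" "\<And>i x. partial i f x = 0"
  shows "\<exists>c. \<forall>x. f x = c"
  using has_derivative_zero_constant[of UNIV f] has_derivative_0_of_partials[OF assms] by auto

lemma smooth_differentiable: "smooth f \<Longrightarrow> f differentiable (at x)"
  using Ck.simps(2)[of 0 f] by (auto simp: smooth_def differentiable_on_def)

lemma smooth_partial: "smooth f \<Longrightarrow> smooth (partial i f)"
  unfolding smooth_def using Ck.simps(2)[of _ f] by auto

lemma smooth_continuous: "smooth f \<Longrightarrow> continuous_on UNIV f"
  unfolding smooth_def using Ck.simps(1)[of f] by blast

lemma partial_component:
  fixes v :: "real^'n::finite \<Rightarrow> real^'m::finite"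
  assumes "v differentiable (at x)"
  shows "partial j (\<lambda>y. v y $ i) x = partial j v x $ i"
  using partial_eqI[OF bounded_linear.has_derivative[OF bounded_linear_vec_nth has_derivative_partial[OF assms]]]
  by (simp add: partial_def)

lemma divergence_eq:
  assumes "v differentiable (at x)"
  shows "divergence v x = (\<Sum>i\<in>UNIV. partial i v x $ i)"
  using assms by (simp add: divergence_def partial_component)

lemma partial_mult:
  fixes f g :: "real^'n::finite \<Rightarrow> real"
  assumes "f differentiable (at x)" "g differentiable (at x)"
  shows "partial j (\<lambda>y. f y * g y) x = f x * partial j g x + partial j f x * g x"
  by (subst partial_eqI[OF has_derivative_mult[OF assms[THEN has_derivative_partial]]]) (simp add: partial_def)

lemma partial_add:
  fixes f g :: "real^'n::finite \<Rightarrow> 'b::real_normed_vector"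
  assumes "f differentiable (at x)" "g differentiable (at x)"
  shows "partial j (\<lambda>y. f y + g y) x = partial j f x + partial j g x"
  by (subst partial_eqI[OF has_derivative_add[OF assms[THEN has_derivative_partial]]]) (simp add: partial_def)

lemma partial_cmult:
  fixes f :: "real^'n::finite \<Rightarrow> real"
  assumes "f differentiable (at x)"
  shows "partial j (\<lambda>y. c * f y) x = c * partial j f x"
  by (subst partial_eqI[OF has_derivative_mult_right[OF has_derivative_partial[OF assms]]]) (simp add: partial_def)

lemma partial_inner:
  fixes f g :: "real^'n::finite \<Rightarrow> real^'m::finite"
  assumes "f differentiable (at x)" "g differentiable (at x)"
  shows "partial j (\<lambda>y. f y \<bullet> g y) x = f x \<bullet> partial j g x + partial j f x \<bullet> g x"
  by (subst partial_eqI[OF has_derivative_inner[OF assms[THEN has_derivative_partial]]]) (simp add: partial_def)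

lemma partial_sum:
  fixes f :: "'i \<Rightarrow> real^'n::finite \<Rightarrow> 'b::real_normed_vector"
  assumes "\<And>i. i \<in> I \<Longrightarrow> f i differentiable (at x)"
  shows "partial j (\<lambda>y. \<Sum>i\<in>I. f i y) x = (\<Sum>i\<in>I. partial j (f i) x)"
  by (subst partial_eqI[OF has_derivative_sum[OF assms[THEN has_derivative_partial]]]) (simp_all add: partial_def)

lemma differentiable_component:
  fixes v :: "real^'n::finite \<Rightarrow> real^'m::finite"
  shows "v differentiable (at x) \<Longrightarrow> (\<lambda>y. v y $ i) differentiable (at x)"
  unfolding differentiable_def by (blast intro: bounded_linear.has_derivative[OF bounded_linear_vec_nth])

lemma differentiable_powr_nonneg:
  fixes f :: "'a::real_normed_vector \<Rightarrow> real"
  shows "f differentiable (at x) \<Longrightarrow> (\<And>y. 0 \<le> f y) \<Longrightarrow> s > 1 \<Longrightarrow> (\<lambda>y. f y powr s) differentiable (at x)"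
  unfolding differentiable_def by (blast intro: has_derivative_powr_nonneg)

lemma partial_powr_nonneg:
  fixes f :: "real^'n::finite \<Rightarrow> real"
  assumes "f differentiable (at x)" "\<And>y. 0 \<le> f y" "s > 1"
  shows "partial j (\<lambda>y. f y powr s) x = s * f x powr (s - 1) * partial j f x"
  by (subst partial_eqI[OF has_derivative_powr_nonneg[OF has_derivative_partial[OF assms(1)] assms(2,3)]])
     (simp add: partial_def)

lemma norm_jacobian_sq:
  fixes v :: "real^'n::finite \<Rightarrow> real^'m::finite"
  shows "(norm (jacobian v (at x)))\<^sup>2 = (\<Sum>j\<in>UNIV. partial j v x \<bullet> partial j v x)"
proof -
  have "(norm (jacobian v (at x)))\<^sup>2 = (\<Sum>i\<in>UNIV. \<Sum>j\<in>UNIV. (partial j v x $ i)\<^sup>2)"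
    unfolding power2_norm_eq_inner by (simp add: inner_vec_def jacobian_component power2_eq_square)
  also have "\<dots> = (\<Sum>j\<in>UNIV. \<Sum>i\<in>UNIV. (partial j v x $ i)\<^sup>2)"
    by (rule sum.swap)
  finally show ?thesis by (simp add: inner_vec_def power2_eq_square)
qed

lemma partial_const [simp]: "partial i (\<lambda>_. c) = (\<lambda>_. 0)"
  by (rule ext, subst partial_eqI[of _ "\<lambda>_. 0"]) auto

lemma smooth_const: "smooth (\<lambda>_ :: real^'n::finite. c)"
proof -
  have "Ck k (\<lambda>_ :: real^'n. c)" for k by (induction k arbitrary: c) auto
  then show ?thesis by (simp add: smooth_def)
qed

section \<open>Integrability of the cube of the velocity\<close>

text \<open>A finite quantity that is bounded by a sublinear power of itself is bounded by the constants
  alone.  Finiteness of \<open>B\<close> has to be known beforehand, hence the truncation in the next lemma.\<close>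

lemma self_improving_bound:
  assumes "B < top" "C < top" "0 < b" "b < 1" "B \<le> C * epow B b"
  shows "B \<le> epow C (1 / (1 - b))"
proof -
  obtain r c where r: "B = ennreal r" "0 \<le> r" and c: "C = ennreal c" "0 \<le> c"
    using assms(1,2) by (cases B; cases C) auto
  show ?thesis
  proof (cases "r = 0")
    case False
    then have r0: "r > 0" using r by simp
    have "ennreal r \<le> ennreal (c * r powr b)"
      using assms r c by (simp add: epow_ennreal ennreal_mult)
    then have "r \<le> c * r powr b" using c r by (subst (asm) ennreal_le_iff) auto
    then have "r powr (1 - b) \<le> c" using r0 by (simp add: powr_diff field_simps)
    then have "(r powr (1 - b)) powr (1 / (1 - b)) \<le> c powr (1 / (1 - b))"
      using assms by (intro powr_mono2) auto
    then have "r \<le> c powr (1 / (1 - b))" using assms r0 by (simp add: powr_powr)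
    then show ?thesis using r c assms by (simp add: epow_ennreal)
  qed (use r in simp)
qed

text \<open>Let \<open>h = |v|\<^sup>2\<close>.  The Sobolev inequality is applied to \<open>w = h powr (5/4)\<close>, whose partial
  derivatives are at most \<open>5/2 * h powr (3/4) * |\<nabla>v|\<close>.  With \<open>B\<close> the integral of \<open>|v|\<^sup>3\<close>, Cauchy--Schwarz bounds the integral
  of this bound by a multiple of the square root of \<open>B\<close>, and Sobolev bounds
  \<open>A\<close>, the integral of \<open>|v| powr (5 q / 2)\<close>, in terms of \<open>B\<close>.  For \<open>2 \<le> N \<le> 6\<close> the exponent \<open>3\<close> lies between \<open>q\<close> and
  \<open>5 q / 2\<close>, so interpolation bounds \<open>B\<close> in terms of \<open>A\<close>, and altogether
  \<open>B \<le> C * epow B (1 - q / 3)\<close>.  The power \<open>5/2\<close> is the one that reaches the exponent \<open>3\<close> in the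
  critical dimension \<open>6\<close>.

  The argument presupposes that \<open>B\<close> is finite and that \<open>w\<close> is integrable.  Both hold if \<open>h\<close> is
  replaced by the bounded function \<open>g e = h / (1 + e h)\<close>, for which the same
  estimates hold with \<open>g e\<close> in place of \<open>h\<close>; they are uniform in \<open>e\<close>, and Fatou's lemma removes the truncation.\<close>

lemma cube_integrable_low_dimension:
  fixes v :: "real^'n::finite \<Rightarrow> real^'m::finite"
  assumes n: "CARD('n) \<ge> 2" "CARD('n) \<le> 6" and N: "N = real CARD('n)"
    and v: "\<And>x. v differentiable (at x)" "\<And>i. continuous_on UNIV (partial i v)"
    and K: "(\<integral>\<^sup>+x. ennreal (norm (v x) powr (N / (N - 1))) \<partial>lborel) < top"
    and D: "(\<integral>\<^sup>+x. ennreal ((norm (jacobian v (at x)))\<^sup>2) \<partial>lborel) < top"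
  shows "(\<integral>\<^sup>+x. ennreal (norm (v x) ^ 3) \<partial>lborel) < top"
proof -
  \<comment> \<open>The number t is the interpolation parameter: 3 = (1 - t) q + t (5 q / 2).\<close>
  define p q t where "p = 1 / (N - 1)" and "q = N / (N - 1)" and "t = (4 * N - 6) / (3 * N)"
  define d where "d x = norm (jacobian v (at x))" for x
  define h where "h x = v x \<bullet> v x" for x
  define g where "g e x = h x / (1 + e * h x)" for e x
  have N2: "2 \<le> N" "N \<le> 6" using n N by auto
  have qp: "q = 1 + p" using N2 by (simp add: q_def p_def field_simps)
  have q: "1 < q" "q \<le> 2" using N2 by (auto simp: q_def field_simps)
  have t: "0 < t" "t \<le> 1" using N2 by (auto simp: t_def field_simps)
  define m where "m = N - 1"
  have m: "N = m + 1" "1 \<le> m" using N2 by (auto simp: m_def)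
  have "q * t = (4 * m - 2) / (3 * m)"
    using m(2) unfolding q_def t_def m(1) by (simp add: divide_simps) (simp add: algebra_simps)
  then have qt: "q * t = 4 / 3 - 2 / 3 * p"
    using m by (simp add: p_def field_simps)
  have e: "q / 2 + 3 / 4 * (q * t) = 3 / 2" and b: "q * t / 2 = 1 - q / 3"
    unfolding qt unfolding qp by (simp_all add: field_simps)
  have "q / 2 * (1 - t) + 5 / 4 * q * t = q / 2 + 3 / 4 * (q * t)"
    by (simp add: field_simps)
  then have tq: "q / 2 * (1 - t) + 5 / 4 * q * t = 3 / 2"
    using e by simp
  have b01: "0 < q * t / 2" "q * t / 2 < 1" using b q t by auto
  have vc: "continuous_on UNIV v"
    using v(1) by (intro differentiable_imp_continuous_on) (auto simp: differentiable_on_def)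
  have [measurable]: "v \<in> borel_measurable borel"
    using vc by (rule borel_measurable_continuous_onI)
  have dc: "continuous_on UNIV d"
    unfolding d_def by (intro continuous_on_norm continuous_jacobian v)
  have [measurable]: "d \<in> borel_measurable borel"
    using dc by (rule borel_measurable_continuous_onI)
  have [measurable]: "h \<in> borel_measurable borel" "g e \<in> borel_measurable borel" for e
    unfolding h_def g_def by measurable
  have hc: "continuous_on UNIV h" unfolding h_def by (intro continuous_intros vc)
  have h0: "0 \<le> h x" for x by (simp add: h_def)
  have hpos: "0 < 1 + e * h x" "1 \<le> 1 + e * h x" if "e > 0" for e x
    using that h0[of x] by (auto intro: add_pos_nonneg)
  have g0: "0 \<le> g e x" "g e x \<le> h x" "g e x \<le> 1 / e" if "e > 0" for e x
  proof -
    note p = hpos[OF that, of x]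
    show "0 \<le> g e x" using p h0[of x] by (simp add: g_def)
    show "g e x \<le> h x"
      using divide_left_mono[OF p(2) h0[of x]] p(1) by (simp add: g_def)
    show "g e x \<le> 1 / e"
      using that unfolding g_def pos_divide_le_eq[OF p(1)] by (simp add: field_simps)
  qed
  have hv: "h x powr (s / 2) = norm (v x) powr s" for x s
    by (cases "v x = 0") (simp_all add: h_def dot_square_norm powr_powr flip: powr_numeral)
  define K' where "K' = (\<integral>\<^sup>+x. ennreal (h x powr (q / 2)) \<partial>lborel)"
  define D' where "D' = (\<integral>\<^sup>+x. ennreal ((d x)\<^sup>2) \<partial>lborel)"
  have K': "K' < top" using K unfolding K'_def hv q_def .
  have D': "D' < top" using D by (simp add: D'_def d_def)
  have fin: "(\<integral>\<^sup>+x. ennreal (g e x powr s) \<partial>lborel) < top" if e: "e > 0" and s: "s \<ge> q / 2" for e s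
  proof -
    have "g e x powr s \<le> (1 / e) powr (s - q / 2) * h x powr (q / 2)" for x
    proof -
      have "g e x powr s = g e x powr (s - q / 2) * g e x powr (q / 2)"
        by (simp flip: powr_add)
      also have "\<dots> \<le> (1 / e) powr (s - q / 2) * h x powr (q / 2)"
        using g0[OF e, of x] q s by (intro mult_mono powr_mono2) auto
      finally show ?thesis .
    qed
    then have "(\<integral>\<^sup>+x. ennreal (g e x powr s) \<partial>lborel)
        \<le> (\<integral>\<^sup>+x. ennreal ((1 / e) powr (s - q / 2)) * ennreal (h x powr (q / 2)) \<partial>lborel)"
      by (intro nn_integral_mono) (simp flip: ennreal_mult)
    also have "\<dots> = ennreal ((1 / e) powr (s - q / 2)) * K'"
      unfolding K'_def by (rule nn_integral_cmult) measurable
    also have "\<dots> < top" using K' by (simp add: ennreal_mult_less_top)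
    finally show ?thesis .
  qed
  define C where "C = epow K' (1 - t) * epow (ennreal (5 / 2)) (q * t) * epow D' (q * t / 2)"
  have C: "C < top" unfolding C_def
    by (intro ennreal_mult_less_top[THEN iffD2] conjI disjI2 epow_less_top)
       (auto simp: ennreal_mult_less_top epow_less_top K' D')
  define M where "M = epow C (1 / (1 - q * t / 2))"
  have M: "M < top" unfolding M_def by (rule epow_less_top[OF C])
  have main: "(\<integral>\<^sup>+x. ennreal (g e x powr (3/2)) \<partial>lborel) \<le> M" if e: "e > 0" for e
  proof -
    define w where "w x = g e x powr (5/4)" for x
    define f where "f x = 5 / 2 * (g e x powr (3/4) * d x)" for x
    define B where "B = (\<integral>\<^sup>+x. ennreal (g e x powr (3/2)) \<partial>lborel)"
    define A where "A = (\<integral>\<^sup>+x. ennreal (g e x powr (5/4*q)) \<partial>lborel)"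
    have B: "B < top" unfolding B_def using e q by (intro fin) auto
    have wd: "(w has_derivative (\<lambda>k. 5/4 * g e x powr (1/4) *
        (2 * (v x \<bullet> frechet_derivative v (at x) k) / (1 + e * h x)\<^sup>2))) (at x)" for x
    proof -
      let ?D = "frechet_derivative v (at x)"
      have "(h has_derivative (\<lambda>k. 2 * (v x \<bullet> ?D k))) (at x)"
        unfolding h_def using has_derivative_partial[OF v(1)]
        by (auto intro!: derivative_eq_intros simp: inner_commute)
      then have "(g e has_derivative (\<lambda>k. 2 * (v x \<bullet> ?D k) / (1 + e * h x)\<^sup>2)) (at x)"
        unfolding g_def using hpos(1)[OF e, of x]
        by (auto intro!: derivative_eq_intros simp: field_simps power2_eq_square)
      from has_derivative_powr_nonneg[OF this g0(1)[OF e], of "5/4"] show ?thesis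
        unfolding w_def by simp
    qed
    have pw: "partial j w x = 5/4 * g e x powr (1/4) * (2 * (v x \<bullet> partial j v x) / (1 + e * h x)\<^sup>2)" for j x
      using partial_eqI[OF wd] by (simp add: partial_def)
    have gc: "continuous_on UNIV (g e)"
      unfolding g_def using hpos(1)[OF e] by (intro continuous_intros hc) (metis less_irrefl)
    have pwc: "continuous_on UNIV (partial j w)" for j
    proof -
      have 1: "continuous_on UNIV (\<lambda>x. g e x powr (1/4))"
        using g0(1)[OF e] by (intro continuous_on_powr' gc continuous_intros) auto
      have 2: "continuous_on UNIV (\<lambda>x. 2 * (v x \<bullet> partial j v x) / (1 + e * h x)\<^sup>2)"
        using hpos(1)[OF e] by (intro continuous_intros hc vc v(2)) (auto simp: less_imp_neq[symmetric])
      show ?thesis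
        unfolding pw[abs_def] by (intro continuous_on_mult[OF continuous_on_mult[OF continuous_on_const 1] 2])
    qed
    have bound: "ennreal \<bar>partial j w x\<bar> \<le> ennreal (f x)" for j x
    proof (rule ennreal_leI)
      have 1: "\<bar>v x \<bullet> partial j v x\<bar> \<le> norm (v x) * d x"
        unfolding d_def
        by (rule order_trans[OF Cauchy_Schwarz_ineq2 mult_left_mono[OF norm_partial_le_jacobian norm_ge_zero]])
      have 2: "norm (v x) / (1 + e * h x)\<^sup>2 \<le> g e x powr (1/2)"
      proof -
        have "sqrt (1 + e * h x) \<le> (1 + e * h x)\<^sup>2"
        proof (rule real_le_lsqrt)
          show "1 + e * h x \<le> ((1 + e * h x)\<^sup>2)\<^sup>2"
            using hpos(2)[OF e, of x] self_le_power[of "1 + e * h x" 4] by simp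
        qed (use hpos(1)[OF e, of x] in auto)
        then have "norm (v x) / (1 + e * h x)\<^sup>2 \<le> norm (v x) / sqrt (1 + e * h x)"
          using hpos(1)[OF e, of x] by (intro divide_left_mono) auto
        also have "\<dots> = g e x powr (1/2)"
          using g0(1)[OF e, of x] by (simp add: powr_half_sqrt g_def real_sqrt_divide h_def norm_eq_sqrt_inner)
        finally show ?thesis .
      qed
      have "\<bar>partial j w x\<bar> = 5/2 * (g e x powr (1/4) * (\<bar>v x \<bullet> partial j v x\<bar> / (1 + e * h x)\<^sup>2))"
        by (simp add: pw abs_mult)
      also have "\<dots> \<le> 5/2 * (g e x powr (1/4) * (norm (v x) * d x / (1 + e * h x)\<^sup>2))"
        using 1 by (intro mult_left_mono divide_right_mono) auto
      also have "\<dots> = 5/2 * (g e x powr (1/4) * (norm (v x) / (1 + e * h x)\<^sup>2) * d x)"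
        by simp
      also have "\<dots> \<le> 5/2 * (g e x powr (1/4) * g e x powr (1/2) * d x)"
        using 2 by (intro mult_left_mono mult_right_mono) (auto simp: d_def)
      also have "\<dots> = f x" by (simp add: f_def flip: powr_add)
      finally show "\<bar>partial j w x\<bar> \<le> f x" .
    qed
    have f: "(\<integral>\<^sup>+x. ennreal (f x) \<partial>lborel) \<le> ennreal (5/2) * (epow B (1/2) * epow D' (1/2))"
    proof -
      have "(\<integral>\<^sup>+x. ennreal (f x) \<partial>lborel) = ennreal (5/2) * (\<integral>\<^sup>+x. ennreal (g e x powr (3/4) * d x) \<partial>lborel)"
        unfolding f_def by (subst nn_integral_cmult[symmetric]) (measurable, intro nn_integral_cong ennreal_mult', simp)
      also have "(\<integral>\<^sup>+x. ennreal (g e x powr (3/4) * d x) \<partial>lborel)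
         = (\<integral>\<^sup>+x. epow (ennreal (g e x powr (3/2))) (1 - 1/2) * epow (ennreal ((d x)\<^sup>2)) (1/2) \<partial>lborel)"
        by (intro nn_integral_cong)
           (auto simp: epow_ennreal powr_powr ennreal_mult d_def powr_half_sqrt)
      also have "\<dots> \<le> epow B (1 - 1/2) * epow D' (1/2)"
        unfolding B_def D'_def by (intro nn_integral_Holder2) auto
      finally show ?thesis by (simp add: mult_left_mono)
    qed
    have A: "A \<le> epow (\<integral>\<^sup>+x. ennreal (f x) \<partial>lborel) q"
    proof -
      have "(\<integral>\<^sup>+x. epow (ennreal \<bar>w x\<bar>) (1 + p) \<partial>lborel) \<le> epow (\<integral>\<^sup>+x. ennreal (f x) \<partial>lborel) (1 + p)"
      proof (rule Gagliardo_Nirenberg_Sobolev[OF n(1) _ _ pwc _ bound])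
        show "p = 1 / (real CARD('n) - 1)" by (simp add: p_def N)
        show "w differentiable (at x)" for x using wd[of x] by (rule differentiableI)
        show "(\<lambda>x. ennreal (f x)) \<in> borel_measurable borel" unfolding f_def by measurable
        show "(\<integral>\<^sup>+x. ennreal \<bar>w x\<bar> \<partial>lborel) < top"
          using fin[OF e, of "5/4"] q by (simp add: w_def)
      qed
      moreover have "epow (ennreal \<bar>w x\<bar>) (1 + p) = ennreal (g e x powr (5/4*q))" for x
        using q by (simp add: w_def epow_ennreal powr_powr qp[symmetric])
      ultimately show ?thesis by (simp add: A_def qp)
    qed
    have "B = (\<integral>\<^sup>+x. epow (ennreal (g e x powr (q/2))) (1 - t) * epow (ennreal (g e x powr (5/4*q))) t \<partial>lborel)"
      unfolding B_def
    proof (intro nn_integral_cong)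
      fix x
      have "g e x powr (3/2) = g e x powr (q/2*(1-t)) * g e x powr (5/4*q*t)"
        by (simp only: tq flip: powr_add)
      then show "ennreal (g e x powr (3/2)) = epow (ennreal (g e x powr (q/2))) (1 - t) * epow (ennreal (g e x powr (5/4*q))) t"
        using t tq by (cases "t = 1") (auto simp: epow_ennreal powr_powr ennreal_mult)
    qed
    also have "\<dots> \<le> epow (\<integral>\<^sup>+x. ennreal (g e x powr (q/2)) \<partial>lborel) (1 - t) * epow A t"
      unfolding A_def using t by (intro nn_integral_Holder2) auto
    also have "\<dots> \<le> epow K' (1 - t) * epow (epow (ennreal (5/2) * (epow B (1/2) * epow D' (1/2))) q) t"
      unfolding K'_def using t q g0[OF e]
      by (intro mult_mono epow_mono order_trans[OF A] f nn_integral_mono ennreal_leI powr_mono2) auto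
    also have "\<dots> = C * epow B (q * t / 2)"
      using t q b01 by (simp add: C_def epow_epow epow_mult ac_simps)
    finally show ?thesis
      unfolding M_def B_def[symmetric] using B C b01 by (intro self_improving_bound) auto
  qed
  have lim: "(\<lambda>n. ennreal (g (1 / real (Suc n)) x powr (3/2))) \<longlonglongrightarrow> ennreal (norm (v x) ^ 3)" for x
  proof -
    have "(\<lambda>n. g (1 / real (Suc n)) x) \<longlonglongrightarrow> h x / (1 + 0 * h x)"
      unfolding g_def by (intro tendsto_intros LIMSEQ_Suc[OF lim_1_over_n]) auto
    then have "(\<lambda>n. g (1 / real (Suc n)) x powr (3/2)) \<longlonglongrightarrow> h x powr (3/2)"
      using g0(1) by (intro tendsto_powr' tendsto_intros) auto
    moreover have "h x powr (3/2) = norm (v x) ^ 3" using hv[of x 3] by simp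
    ultimately show ?thesis by (intro tendsto_ennrealI) simp
  qed
  have "(\<integral>\<^sup>+x. ennreal (norm (v x) ^ 3) \<partial>lborel)
      = (\<integral>\<^sup>+x. liminf (\<lambda>n. ennreal (g (1 / real (Suc n)) x powr (3/2))) \<partial>lborel)"
    by (intro nn_integral_cong lim_imp_Liminf[symmetric] lim) simp
  also have "\<dots> \<le> liminf (\<lambda>n. \<integral>\<^sup>+x. ennreal (g (1 / real (Suc n)) x powr (3/2)) \<partial>lborel)"
    by (intro nn_integral_liminf) measurable
  also have "\<dots> \<le> liminf (\<lambda>n. M)"
    by (intro Liminf_mono always_eventually allI main) simp
  also have "\<dots> = M" by (simp add: Liminf_const)
  finally show ?thesis using M by simp
qed

lemma interpolation_integrable:
  fixes f :: "'a::euclidean_space \<Rightarrow> real"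
  assumes [measurable]: "f \<in> borel_measurable borel" and f0: "\<And>x. 0 \<le> f x"
    and "a \<le> s" "s \<le> b"
    and A: "(\<integral>\<^sup>+x. ennreal (f x powr a) \<partial>lborel) < top" and B: "(\<integral>\<^sup>+x. ennreal (f x powr b) \<partial>lborel) < top"
  shows "(\<integral>\<^sup>+x. ennreal (f x powr s) \<partial>lborel) < top"
proof -
  have "f x powr s \<le> f x powr a + f x powr b" for x
  proof (cases "f x \<le> 1")
    case True
    then have "f x powr s \<le> f x powr a" using assms f0 by (intro powr_mono') auto
    then show ?thesis by (simp add: add_increasing2)
  next
    case False
    then have "f x powr s \<le> f x powr b" using assms by (intro powr_mono) auto
    then show ?thesis by (simp add: add_increasing)
  qed
  then have "(\<integral>\<^sup>+x. ennreal (f x powr s) \<partial>lborel) \<le> (\<integral>\<^sup>+x. ennreal (f x powr a) + ennreal (f x powr b) \<partial>lborel)"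
    by (intro nn_integral_mono) (simp flip: ennreal_plus)
  also have "\<dots> = (\<integral>\<^sup>+x. ennreal (f x powr a) \<partial>lborel) + (\<integral>\<^sup>+x. ennreal (f x powr b) \<partial>lborel)"
    by (rule nn_integral_add) measurable
  also have "\<dots> < top" using A B by simp
  finally show ?thesis .
qed

section \<open>Integration by parts\<close>

lemma partial_eq_0_outside:
  fixes F :: "real^'n::finite \<Rightarrow> 'b::real_normed_vector"
  assumes "\<And>x. norm x > R \<Longrightarrow> F x = 0" "norm x > R"
  shows "partial j F x = 0"
proof -
  have "((\<lambda>_. 0) has_derivative (\<lambda>_. 0)) (at x)" by simp
  moreover have "open {x::real^'n. norm x > R}"
    by (intro open_Collect_less continuous_intros)
  ultimately have "(F has_derivative (\<lambda>_. 0)) (at x)"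
    by (rule has_derivative_transform_within_open) (use assms in auto)
  then show ?thesis by (simp add: partial_def frechet_derivative_at[symmetric])
qed

lemma integrable_compact_support:
  fixes f :: "'a::euclidean_space \<Rightarrow> real"
  assumes "continuous_on UNIV f" "\<And>x. norm x > R \<Longrightarrow> f x = 0"
  shows "integrable lborel f"
proof -
  have "integrable lborel (\<lambda>x. indicator (cball 0 R) x *\<^sub>R f x)"
    using assms by (intro borel_integrable_compact continuous_on_subset[OF assms(1)]) auto
  also have "(\<lambda>x. indicator (cball 0 R) x *\<^sub>R f x) = f"
    using assms(2) by (force simp: indicator_def)
  finally show ?thesis .
qed

text \<open>On every line in direction \<open>j\<close> the fundamental theorem of calculus gives \<open>0\<close>.\<close>

lemma integral_partial_eq_0:
  fixes F :: "real^'n::finite \<Rightarrow> real"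
  assumes F: "\<And>x. F differentiable (at x)" "continuous_on UNIV (partial j F)"
    and supp: "\<And>x. norm x > R \<Longrightarrow> F x = 0"
  shows "(\<integral>x. partial j F x \<partial>lborel) = 0"
proof -
  let ?P = "\<lambda>s::'n set. PiM s (\<lambda>_. lborel :: real measure)"
  let ?v = "\<lambda>x. (\<chi> i. x i) :: real^'n"
  let ?s = "UNIV - {j}"
  have u: "insert j ?s = UNIV" by auto
  have [measurable]: "partial j F \<in> borel_measurable borel"
    using F(2) by (rule borel_measurable_continuous_onI)
  have "integrable lborel (partial j F)"
    using partial_eq_0_outside[of R F, OF supp] by (intro integrable_compact_support[of _ R] F) auto
  then have i: "integrable (?P UNIV) (\<lambda>x. partial j F (?v x))"
    unfolding lborel_vec by (subst (asm) integrable_distr_eq) auto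
  have "(\<integral>x. partial j F x \<partial>lborel) = (\<integral>x. partial j F (?v x) \<partial>?P UNIV)"
    unfolding lborel_vec by (rule integral_distr) auto
  also have "\<dots> = (\<integral>x. (\<integral>y. partial j F (?v (x(j := y))) \<partial>lborel) \<partial>?P ?s)"
    using lborel_PiM.product_integral_insert[of ?s j "\<lambda>x. partial j F (?v x)"] i by (simp add: u)
  also have "\<dots> = 0"
  proof -
    have "(\<integral>y. partial j F (?v (x(j := y))) \<partial>lborel) = 0" for x
  proof -
    define r where "r = \<bar>R\<bar> + 1"
    have nv: "R < norm (?v (x(j := y)))" if "r \<le> \<bar>y\<bar>" for y
      using component_le_norm_cart[of "?v (x(j := y))" j] that by (simp add: r_def)
    have c: "continuous_on UNIV (\<lambda>y. partial j F (?v (x(j := y))))"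
      by (intro continuous_on_compose2[OF F(2)] continuous_line) auto
    have "(\<integral>y. partial j F (?v (x(j := y))) \<partial>lborel)
        = (\<integral>y. indicator {-r..r} y *\<^sub>R partial j F (?v (x(j := y))) \<partial>lborel)"
    proof (intro Bochner_Integration.integral_cong refl)
      fix y :: real
      show "partial j F (?v (x(j := y))) = indicator {-r..r} y *\<^sub>R partial j F (?v (x(j := y)))"
      proof (cases "\<bar>y\<bar> \<le> r")
        case False
        then have "partial j F (?v (x(j := y))) = 0"
          by (intro partial_eq_0_outside[of R F, OF supp] nv) auto
        then show ?thesis by (simp del: fun_upd_apply)
      qed (auto simp: indicator_def)
    qed
    also have "\<dots> = F (?v (x(j := r))) - F (?v (x(j := -r)))"
      using partial_line[OF F(1), of x j]
      by (intro integral_FTC_atLeastAtMost continuous_on_subset[OF c])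
        (auto simp: r_def intro: has_field_derivative_at_within simp flip: has_real_derivative_iff_has_vector_derivative)
    also have "\<dots> = 0" using supp nv by (simp add: r_def)
    finally show ?thesis .
    qed
    then show ?thesis by (simp del: fun_upd_apply)
  qed
  finally show ?thesis .
qed

section \<open>Cutoff functions\<close>

text \<open>A \<open>C\<^sup>1\<close> cutoff suffices, because the viscous term is integrated by parts only once.  Instead
  of being \<open>1\<close> on a smaller ball it has a positive lower bound there, which serves equally well
  for a nonnegative dissipation.\<close>

definition cutoff :: "real \<Rightarrow> 'a::euclidean_space \<Rightarrow> real" where
  "cutoff R x = (max 0 (1 - (x \<bullet> x) / R\<^sup>2))\<^sup>2"

lemma max_sq_deriv: "((\<lambda>t::real. (max 0 t)\<^sup>2) has_real_derivative 2 * max 0 t) (at t)"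
proof (cases t "0::real" rule: linorder_cases)
  case less
  have "((\<lambda>_. 0) has_real_derivative 2 * max 0 t) (at t)" using less by simp
  then show ?thesis
    by (rule has_field_derivative_transform_within_open[of _ _ _ "{..<0}"]) (use less in \<open>auto simp: max_def\<close>)
next
  case equal
  have "((\<lambda>h::real. ((max 0 (0 + h))\<^sup>2 - (max 0 0)\<^sup>2) / h) \<longlongrightarrow> 0) (at 0)"
  proof (rule Lim_null_comparison)
    show "((\<lambda>h::real. \<bar>h\<bar>) \<longlongrightarrow> 0) (at 0)" by (intro tendsto_rabs_zero tendsto_ident_at)
    have "norm (((max 0 (0 + h))\<^sup>2 - (max 0 0)\<^sup>2) / h) \<le> \<bar>h\<bar>" for h :: real
      by (cases "h = 0") (auto simp: max_def power2_eq_square)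
    then show "\<forall>\<^sub>F h in at 0. norm (((max 0 (0 + h))\<^sup>2 - (max 0 0)\<^sup>2) / h) \<le> \<bar>h\<bar>" for h :: real
      by simp
  qed
  then show ?thesis using equal by (simp add: DERIV_def)
next
  case greater
  have "((\<lambda>t. t\<^sup>2) has_real_derivative 2 * max 0 t) (at t)" using greater by (auto intro!: derivative_eq_intros)
  then show ?thesis
    by (rule has_field_derivative_transform_within_open[of _ _ _ "{0<..}"]) (use greater in \<open>auto simp: max_def\<close>)
qed

lemma cutoff_has_derivative:
  "(cutoff R has_derivative (\<lambda>k. 2 * max 0 (1 - (x \<bullet> x) / R\<^sup>2) * (- (2 * (x \<bullet> k) / R\<^sup>2)))) (at x)"
proof -
  have "((\<lambda>x. 1 - (x \<bullet> x) / R\<^sup>2) has_derivative (\<lambda>k. - (2 * (x \<bullet> k) / R\<^sup>2))) (at x)"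
    unfolding divide_inverse by (auto intro!: derivative_eq_intros simp: inner_commute algebra_simps)
  from has_derivative_compose[OF this max_sq_deriv[unfolded has_field_derivative_def]]
  show ?thesis unfolding cutoff_def[abs_def] .
qed

lemma partial_cutoff:
  "partial j (cutoff R) x = 2 * max 0 (1 - (x \<bullet> x) / R\<^sup>2) * (- (2 * (x $ j) / R\<^sup>2))"
  using partial_eqI[OF cutoff_has_derivative] by (simp add: inner_axis)

lemma cutoff_outside:
  assumes "0 < R" "norm x > R" shows "max 0 (1 - (x \<bullet> x) / R\<^sup>2) = 0"
proof -
  have "R\<^sup>2 \<le> (norm x)\<^sup>2" using assms by (intro power_mono) auto
  then show ?thesis using assms by (simp add: power2_norm_eq_inner field_simps)
qed

lemma cutoff_continuous: "continuous_on UNIV (cutoff R)"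
  unfolding cutoff_def[abs_def] divide_inverse by (intro continuous_intros)

lemma partial_cutoff_continuous: "continuous_on UNIV (partial j (cutoff R))"
  unfolding partial_cutoff[abs_def] divide_inverse by (intro continuous_intros)

lemma partial_cutoff_bound:
  fixes x :: "real^'n::finite"
  assumes "0 < R"
  shows "\<bar>partial j (cutoff R) x\<bar> \<le> 4 / R * indicator (cball 0 R) x"
proof (cases "norm x \<le> R")
  case True
  have "max 0 (1 - (x \<bullet> x) / R\<^sup>2) \<le> 1" by simp
  moreover have "\<bar>x $ j\<bar> \<le> R" using True component_le_norm_cart[of x j] by simp
  then have "2 * \<bar>x $ j\<bar> / R\<^sup>2 \<le> 2 / R"
    using assms by (simp add: field_simps power2_eq_square)
  ultimately have "2 * max 0 (1 - (x \<bullet> x) / R\<^sup>2) * (2 * \<bar>x $ j\<bar> / R\<^sup>2) \<le> 2 * 1 * (2 / R)"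
    by (intro mult_mono) auto
  then show ?thesis using True by (simp add: partial_cutoff abs_mult)
next
  case False
  then show ?thesis using assms cutoff_outside[of R x] by (simp add: partial_cutoff)
qed

lemma cutoff_lower:
  assumes "0 < R" "norm x \<le> R / 2"
  shows "1 / 2 \<le> cutoff R x"
proof -
  have "(norm x)\<^sup>2 \<le> (R / 2)\<^sup>2" using assms by (intro power_mono) auto
  then have "3 / 4 \<le> 1 - (x \<bullet> x) / R\<^sup>2"
    using assms by (simp add: power2_norm_eq_inner field_simps)
  then have "(3 / 4)\<^sup>2 \<le> cutoff R x"
    unfolding cutoff_def by (intro power_mono max.coboundedI2) auto
  then show ?thesis by (simp add: power2_eq_square)
qed

lemma cutoff_nonneg: "0 \<le> cutoff R x"
  by (simp add: cutoff_def)

section \<open>Decay of averages\<close>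

text \<open>Nonempty open sets are not null sets.\<close>

lemma AE_le_imp_le:
  fixes f :: "'a::euclidean_space \<Rightarrow> real"
  assumes c: "continuous_on UNIV f" and ae: "AE x in lebesgue. f x \<le> c"
  shows "f x \<le> c"
proof (rule ccontr)
  assume "\<not> f x \<le> c"
  then have "{x. c < f x} \<noteq> {}" by (auto simp: not_le)
  moreover have "open {x. c < f x}" using c by (intro open_Collect_less continuous_intros) auto
  ultimately have "\<not> negligible {x. c < f x}" by (rule open_not_negligible[rotated])
  moreover have "negligible {x. c < f x}"
    using ae by (simp add: negligible_iff_null_sets eventually_ae_filter not_le)
      (auto intro: completion.complete2 elim: null_sets_subset)
  ultimately show False by simp
qed

text \<open>On the ball of radius \<open>R\<close>, split the values of \<open>u\<close> at the level
  \<open>l = \<tau> R powr (1 - N)\<close>.  Values below \<open>l\<close> contribute at most \<open>\<tau>\<close> times the volume of the unit ball,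
  after division by \<open>R\<close>.  Above \<open>l\<close>, the quotient \<open>u / R\<close> is at most
  \<open>\<tau> powr (1 - q) * u powr q\<close>, uniformly in \<open>R\<close>, since the powers of \<open>R\<close> cancel for exactly this \<open>q\<close>;
  dominated convergence then lets this part vanish.\<close>

lemma average_tendsto_0:
  fixes u :: "real^'n::finite \<Rightarrow> real"
  assumes n: "CARD('n) \<ge> 2" and N: "N = real CARD('n)"
    and u: "continuous_on UNIV u" "\<And>x. 0 \<le> u x"
    and K: "integrable lborel (\<lambda>x. u x powr (N / (N - 1)))"
  shows "(\<lambda>m. (1 / real (Suc m)) * (\<integral>x. indicator (cball 0 (real (Suc m))) x * u x \<partial>lborel)) \<longlonglongrightarrow> 0"
proof (rule LIMSEQ_I)
  fix e :: real assume e: "0 < e"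
  have N2: "2 \<le> N" using n N by simp
  define q where "q = N / (N - 1)"
  have q1: "q - 1 = 1 / (N - 1)" "1 < q" using N2 by (auto simp: q_def field_simps)
  have [measurable]: "u \<in> borel_measurable borel"
    using u(1) by (rule borel_measurable_continuous_onI)
  define \<omega> where "\<omega> = measure lborel (cball (0::real^'n) 1)"
  define \<tau> where "\<tau> = e / (2 * (\<omega> + 1))"
  have \<omega>: "0 \<le> \<omega>" by (simp add: \<omega>_def)
  have \<tau>: "0 < \<tau>" "\<tau> * \<omega> < e / 2 + 0" using e \<omega> by (auto simp: \<tau>_def field_simps)
  define r where "r m = real (Suc m)" for m
  have r: "1 \<le> r m" "0 < r m" for m by (auto simp: r_def)
  define l where "l m = \<tau> * r m powr (1 - N)" for m
  have l: "0 < l m" for m using \<tau> r[of m] by (simp add: l_def)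
  define f where "f m x = (if norm x \<le> r m \<and> l m < u x then u x / r m else 0)" for m x
  have [measurable]: "f m \<in> borel_measurable lborel" for m
    unfolding f_def by measurable
  have fb: "f m x \<le> \<tau> powr (1 - q) * u x powr q" for m x
  proof (cases "l m < u x")
    case True
    have "u x = u x powr q * u x powr (1 - q)" using True l[of m] by (simp flip: powr_add)
    also have "\<dots> \<le> u x powr q * l m powr (1 - q)"
      using True l[of m] q1 by (intro mult_left_mono powr_mono2') auto
    also have "l m powr (1 - q) = \<tau> powr (1 - q) * r m"
    proof -
      have "(1 - N) * (1 - q) = 1" using N2 by (simp add: q_def field_simps)
      then show ?thesis using \<tau> r[of m] by (simp add: l_def powr_mult powr_powr)
    qed
    finally have "u x / r m \<le> \<tau> powr (1 - q) * u x powr q"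
      using r[of m] by (simp add: field_simps)
    then show ?thesis using u(2) by (simp add: f_def)
  qed (simp add: f_def)
  have f0: "0 \<le> f m x" for m x using u r[of m] by (simp add: f_def)
  have "(\<lambda>m. \<integral>x. f m x \<partial>lborel) \<longlonglongrightarrow> (\<integral>x. 0 \<partial>(lborel :: (real^'n) measure))"
  proof (rule integral_dominated_convergence[where w = "\<lambda>x. \<tau> powr (1 - q) * u x powr q"])
    show "integrable lborel (\<lambda>x. \<tau> powr (1 - q) * u x powr q)" using K by (simp add: q_def)
    show "AE x in lborel. (\<lambda>m. f m x) \<longlonglongrightarrow> 0"
    proof (rule AE_I2)
      fix x
      show "(\<lambda>m. f m x) \<longlonglongrightarrow> 0"
      proof (rule Lim_null_comparison)
        show "(\<lambda>m. u x * (1 / real (Suc m))) \<longlonglongrightarrow> 0"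
          by (intro tendsto_mult_right_zero LIMSEQ_Suc[OF lim_1_over_n])
        show "\<forall>\<^sub>F m in sequentially. norm (f m x) \<le> u x * (1 / real (Suc m))"
          using u(2) by (intro always_eventually) (auto simp: f_def r_def)
      qed
    qed
    show "AE x in lborel. norm (f m x) \<le> \<tau> powr (1 - q) * u x powr q" for m
      using fb f0 by simp
  qed measurable
  then have "(\<lambda>m. \<integral>x. f m x \<partial>lborel) \<longlonglongrightarrow> 0" by simp
  from order_tendstoD(2)[OF this, of "e / 2"] e
  have ev: "\<forall>\<^sub>F m in sequentially. (\<integral>x. f m x \<partial>lborel) < e / 2" by simp
  have fi: "integrable lborel (f m)" for m
    by (rule Bochner_Integration.integrable_bound[of _ "\<lambda>x. \<tau> powr (1 - q) * u x powr q"])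
       (use K fb f0 in \<open>auto simp: q_def intro!: AE_I2\<close>)
  have bound: "(1 / r m) * (\<integral>x. indicator (cball 0 (r m)) x * u x \<partial>lborel) \<le> \<tau> * \<omega> + (\<integral>x. f m x \<partial>lborel)" for m
  proof -
    have ci: "integrable lborel (\<lambda>x. indicator (cball (0::real^'n) (r m)) x * l m / r m)" for m :: nat
      using borel_integrable_compact[of "cball (0::real^'n) (r m)" "\<lambda>_. l m / r m"] by simp
    have "(1 / r m) * (\<integral>x. indicator (cball 0 (r m)) x * u x \<partial>lborel)
        = (\<integral>x. (1 / r m) * (indicator (cball 0 (r m)) x * u x) \<partial>lborel)" by simp
    also have "\<dots> \<le> (\<integral>x. indicator (cball 0 (r m)) x * l m / r m + f m x \<partial>lborel)"
    proof (rule integral_mono)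
      have "integrable lborel (\<lambda>x. indicator (cball 0 (r m)) x *\<^sub>R u x)"
        using u(1) by (intro borel_integrable_compact continuous_on_subset[OF u(1)]) auto
      then show "integrable lborel (\<lambda>x. (1 / r m) * (indicator (cball 0 (r m)) x * u x))" by simp
      show "integrable lborel (\<lambda>x. indicator (cball 0 (r m)) x * l m / r m + f m x)"
        using ci fi by (rule Bochner_Integration.integrable_add)
      show "(1 / r m) * (indicator (cball 0 (r m)) x * u x) \<le> indicator (cball 0 (r m)) x * l m / r m + f m x" for x
        using r[of m] l[of m] by (auto simp: f_def indicator_def divide_right_mono)
    qed
    also have "\<dots> = (\<integral>x. indicator (cball (0::real^'n) (r m)) x * l m / r m \<partial>lborel) + (\<integral>x. f m x \<partial>lborel)"
      using ci[of m] fi[of m] by simp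
    also have "(\<integral>x. indicator (cball (0::real^'n) (r m)) x * l m / r m \<partial>lborel) = measure lborel (cball (0::real^'n) (r m)) * l m / r m"
      by simp
    also have "measure lborel (cball (0::real^'n) (r m)) = \<omega> * r m ^ CARD('n)"
      using r[of m] by (simp add: \<omega>_def content_cball)
    also have "\<omega> * r m ^ CARD('n) * l m / r m = \<tau> * \<omega>"
    proof -
      have "r m ^ CARD('n) * r m powr (1 - N) = r m"
        using r[of m] by (simp add: N powr_realpow[symmetric] flip: powr_add)
      then show ?thesis using r[of m] by (simp add: l_def field_simps)
    qed
    finally show ?thesis .
  qed
  from ev obtain no where no: "\<And>m. m \<ge> no \<Longrightarrow> (\<integral>x. f m x \<partial>lborel) < e / 2"
    unfolding eventually_sequentially by blast
  show "\<exists>no. \<forall>m\<ge>no. norm ((1 / real (Suc m)) * (\<integral>x. indicator (cball 0 (real (Suc m))) x * u x \<partial>lborel) - 0) < e"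
  proof (intro exI allI impI)
    fix m assume "no \<le> m"
    have "0 \<le> (1 / r m) * (\<integral>x. indicator (cball 0 (r m)) x * u x \<partial>lborel)"
      using u r[of m] by (intro mult_nonneg_nonneg integral_nonneg_AE) auto
    with bound[of m] no[OF \<open>no \<le> m\<close>] \<tau>(2)
    show "norm ((1 / real (Suc m)) * (\<integral>x. indicator (cball 0 (real (Suc m))) x * u x \<partial>lborel) - 0) < e"
      unfolding r_def[symmetric] by simp
  qed
qed

section \<open>The energy identity\<close>

text \<open>Component \<open>j\<close> of the flux whose divergence is the dissipation: kinetic energy, pressure, potential
  energy, and the two viscous fluxes.\<close>

definition energy_flux ::
  "real \<Rightarrow> real \<Rightarrow> real \<Rightarrow> real \<Rightarrow> real \<Rightarrow> (real^'n::finite \<Rightarrow> real) \<Rightarrow> (real^'n \<Rightarrow> real^'n)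
    \<Rightarrow> (real^'n \<Rightarrow> real) \<Rightarrow> 'n \<Rightarrow> real^'n \<Rightarrow> real" where
  "energy_flux a \<gamma> k \<mu> lam \<rho> v \<Phi> j x =
     (- (1/2)) * (\<rho> x * (v x \<bullet> v x) * v x $ j)
     + (- (a * \<gamma> / (\<gamma> - 1))) * (\<rho> x powr \<gamma> * v x $ j)
     + k * (\<Phi> x * \<rho> x * v x $ j)
     + \<mu> * (v x \<bullet> partial j v x)
     + (\<mu> + lam) * (v x $ j * divergence v x)"

text \<open>The equations of motion of both systems at once: the one without force is the case \<open>k = 0\<close>, \<open>\<Phi> = 0\<close>.\<close>

locale smooth_flow =
  fixes a \<gamma> k \<mu> lam :: real and \<rho> :: "real^'n::finite \<Rightarrow> real" and v :: "real^'n \<Rightarrow> real^'n" and \<Phi> :: "real^'n \<Rightarrow> real"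
  assumes \<gamma>: "\<gamma> > 1"
    and smooth: "smooth \<rho>" "smooth v" "smooth \<Phi>"
    and nonneg: "\<And>x. 0 \<le> \<rho> x"
    and mass: "\<And>x. divergence (\<lambda>y. \<rho> y *\<^sub>R v y) x = 0"
    and momentum: "\<And>x. div_flux \<rho> v x =
        - grad (pressure a \<gamma> \<rho>) x + (k * \<rho> x) *\<^sub>R grad \<Phi> x
        + \<mu> *\<^sub>R laplacian v x + (\<mu> + lam) *\<^sub>R grad (divergence v) x"
begin

abbreviation "G \<equiv> energy_flux a \<gamma> k \<mu> lam \<rho> v \<Phi>"

lemmas d\<rho> = smooth_differentiable[OF smooth(1)]
lemmas dv = smooth_differentiable[OF smooth(2)]
lemmas d\<Phi> = smooth_differentiable[OF smooth(3)]
lemmas dpv = smooth_differentiable[OF smooth_partial[OF smooth(2)]]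

lemma dvc: "(\<lambda>y. v y $ i) differentiable (at x)"
  by (rule differentiable_component[OF dv])

lemma divergence_v: "divergence v = (\<lambda>x. \<Sum>i\<in>UNIV. partial i v x $ i)"
  using dv by (auto simp: divergence_eq)

lemma ddiv: "divergence v differentiable (at x)"
  unfolding divergence_v by (intro differentiable_sum ballI differentiable_component dpv) auto

lemma dpow: "(\<lambda>y. \<rho> y powr \<gamma>) differentiable (at x)"
  by (intro differentiable_powr_nonneg d\<rho> nonneg \<gamma>)

lemma partial_pow: "partial j (\<lambda>y. \<rho> y powr \<gamma>) x = \<gamma> * \<rho> x powr (\<gamma> - 1) * partial j \<rho> x"
  by (intro partial_powr_nonneg d\<rho> nonneg \<gamma>)

lemma dG: "G j differentiable (at x)"
  unfolding energy_flux_def[abs_def]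
  by (intro differentiable_add differentiable_mult differentiable_const differentiable_inner d\<rho> dv d\<Phi> dpv dvc ddiv dpow)

text \<open>Arranged so that the combinations which conservation of mass determines after summation over \<open>j\<close> stand
  together.\<close>

lemma partial_G: "partial j (G j) x =
     (- (1/2)) * ((partial j \<rho> x * v x $ j + \<rho> x * partial j v x $ j) * (v x \<bullet> v x) + 2 * (\<rho> x * (v x $ j * (v x \<bullet> partial j v x))))
     + (- (a * \<gamma> / (\<gamma> - 1))) * (\<gamma> * \<rho> x powr (\<gamma> - 1) * (partial j \<rho> x * v x $ j) + \<rho> x powr \<gamma> * partial j v x $ j)
     + k * (partial j \<Phi> x * \<rho> x * v x $ j + \<Phi> x * (partial j \<rho> x * v x $ j + \<rho> x * partial j v x $ j))
     + \<mu> * (partial j v x \<bullet> partial j v x + v x \<bullet> partial j (partial j v) x)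
     + (\<mu> + lam) * (partial j v x $ j * divergence v x + v x $ j * partial j (divergence v) x)"
proof -
  note d = d\<rho> dv d\<Phi> dpv dvc ddiv dpow
  have 1: "partial j (\<lambda>x. \<rho> x * (v x \<bullet> v x) * v x $ j) x
      = (partial j \<rho> x * v x $ j + \<rho> x * partial j v x $ j) * (v x \<bullet> v x) + 2 * (\<rho> x * (v x $ j * (v x \<bullet> partial j v x)))"
    by (simp add: partial_mult partial_inner partial_component differentiable_mult differentiable_inner d inner_commute algebra_simps)
  have 2: "partial j (\<lambda>x. \<rho> x powr \<gamma> * v x $ j) x
      = \<gamma> * \<rho> x powr (\<gamma> - 1) * (partial j \<rho> x * v x $ j) + \<rho> x powr \<gamma> * partial j v x $ j"
    by (simp add: partial_mult partial_pow partial_component d algebra_simps)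
  have 3: "partial j (\<lambda>x. \<Phi> x * \<rho> x * v x $ j) x
      = partial j \<Phi> x * \<rho> x * v x $ j + \<Phi> x * (partial j \<rho> x * v x $ j + \<rho> x * partial j v x $ j)"
    by (simp add: partial_mult partial_component differentiable_mult d algebra_simps)
  have 4: "partial j (\<lambda>x. v x \<bullet> partial j v x) x = partial j v x \<bullet> partial j v x + v x \<bullet> partial j (partial j v) x"
    by (simp add: partial_inner d)
  have 5: "partial j (\<lambda>x. v x $ j * divergence v x) x = partial j v x $ j * divergence v x + v x $ j * partial j (divergence v) x"
    by (simp add: partial_mult partial_component d)
  note dd = differentiable_add differentiable_mult differentiable_inner differentiable_const d
  show ?thesis
    unfolding energy_flux_def[abs_def]
    by (simp only: partial_add partial_cmult dd 1 2 3 4 5)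
qed

lemma sum_grad_density_velocity: "(\<Sum>j\<in>UNIV. partial j \<rho> x * v x $ j) = - \<rho> x * divergence v x"
proof -
  have "partial j (\<lambda>y. (\<rho> y *\<^sub>R v y) $ j) x = \<rho> x * partial j v x $ j + partial j \<rho> x * v x $ j" for j
    by (simp add: partial_mult partial_component d\<rho> dvc dv)
  then have "(\<Sum>j\<in>UNIV. \<rho> x * partial j v x $ j + partial j \<rho> x * v x $ j) = 0"
    using mass[of x] by (simp add: divergence_def)
  then show ?thesis
    by (simp add: sum.distrib sum_distrib_left[symmetric] divergence_v)
qed

text \<open>Summing \<open>partial_G\<close> over \<open>j\<close> leaves, besides the dissipation, exactly the terms of the momentum
  equation tested with \<open>v\<close> (fact \<open>m\<close> below).  Conservation of mass enters twice: as \<open>s4\<close>, which removes the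
  terms with undifferentiated \<open>|v|\<^sup>2\<close> and \<open>\<Phi>\<close>, and as \<open>s1\<close>, which turns both pressure terms into
  multiples of \<open>P * d\<close>.\<close>

lemma energy_identity:
  "(\<Sum>j\<in>UNIV. partial j (G j) x) = \<mu> * (norm (jacobian v (at x)))\<^sup>2 + (\<mu> + lam) * (divergence v x)\<^sup>2"
proof -
  define d where "d = divergence v x"
  define T where "T = (\<Sum>j\<in>UNIV. v x $ j * (v x \<bullet> partial j v x))"
  define F where "F = (\<Sum>j\<in>UNIV. partial j \<Phi> x * v x $ j)"
  define L where "L = (\<Sum>j\<in>UNIV. v x \<bullet> partial j (partial j v) x)"
  define B where "B = (\<Sum>j\<in>UNIV. v x $ j * partial j (divergence v) x)"
  define J where "J = (norm (jacobian v (at x)))\<^sup>2"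
  define P where "P = \<rho> x powr \<gamma>"
  \<comment> \<open>Also true at vacuum, where both sides are 0.\<close>
  have pow: "\<rho> x powr (\<gamma> - 1) * \<rho> x = P"
    using nonneg[of x] \<gamma> by (cases "\<rho> x = 0") (simp_all add: P_def powr_diff)
  have s1: "(\<Sum>j\<in>UNIV. partial j \<rho> x * v x $ j) = - \<rho> x * d"
    using sum_grad_density_velocity[of x] by (simp add: d_def)
  have s2: "(\<Sum>j\<in>UNIV. partial j v x $ j) = d"
    by (simp add: d_def divergence_v)
  have s3: "(\<Sum>j\<in>UNIV. partial j v x \<bullet> partial j v x) = J"
    by (simp add: J_def norm_jacobian_sq)
  have s4: "(\<Sum>j\<in>UNIV. partial j \<rho> x * v x $ j + \<rho> x * partial j v x $ j) = 0"
    by (simp add: sum.distrib s1 s2 flip: sum_distrib_left)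
  have m: "\<rho> x * T = a * \<gamma> * P * d + k * \<rho> x * F + \<mu> * L + (\<mu> + lam) * B"
  proof -
    have "v x \<bullet> div_flux \<rho> v x = (\<Sum>i\<in>UNIV. v x $ i * (\<Sum>j\<in>UNIV. partial j (\<lambda>y. \<rho> y * v y $ j * v y $ i) x))"
      by (simp add: inner_vec_def div_flux_def)
    also have "\<dots> = (\<Sum>i\<in>UNIV. \<Sum>j\<in>UNIV. (v x $ i)\<^sup>2 * (partial j \<rho> x * v x $ j + \<rho> x * partial j v x $ j)
          + \<rho> x * (v x $ j * (v x $ i * partial j v x $ i)))"
      by (simp add: partial_mult partial_component differentiable_mult d\<rho> dvc dv sum_distrib_left power2_eq_square algebra_simps)
    also have "\<dots> = (\<Sum>i\<in>UNIV. (v x $ i)\<^sup>2 * (\<Sum>j\<in>UNIV. partial j \<rho> x * v x $ j + \<rho> x * partial j v x $ j))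
        + \<rho> x * (\<Sum>i\<in>UNIV. \<Sum>j\<in>UNIV. v x $ j * (v x $ i * partial j v x $ i))"
      by (simp only: sum.distrib sum_distrib_left distrib_left)
    also have "(\<Sum>i\<in>UNIV. \<Sum>j\<in>UNIV. v x $ j * (v x $ i * partial j v x $ i)) = T"
      unfolding T_def inner_vec_def by (subst sum.swap) (simp add: sum_distrib_left)
    finally have lhs: "v x \<bullet> div_flux \<rho> v x = \<rho> x * T" by (simp add: s4)
    have p: "v x \<bullet> grad (pressure a \<gamma> \<rho>) x = - (a * \<gamma> * P * d)"
    proof -
      have "partial j (pressure a \<gamma> \<rho>) x = a * (\<gamma> * \<rho> x powr (\<gamma> - 1) * partial j \<rho> x)" for j
        unfolding pressure_def[abs_def] by (simp add: partial_cmult dpow partial_pow)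
      then have "v x \<bullet> grad (pressure a \<gamma> \<rho>) x = a * \<gamma> * \<rho> x powr (\<gamma> - 1) * (\<Sum>j\<in>UNIV. partial j \<rho> x * v x $ j)"
        by (simp add: inner_vec_def grad_def sum_distrib_left ac_simps)
      also have "\<dots> = - (a * \<gamma> * (\<rho> x powr (\<gamma> - 1) * \<rho> x) * d)" by (simp add: s1)
      finally show ?thesis by (simp add: pow)
    qed
    have f: "v x \<bullet> grad \<Phi> x = F" by (simp add: inner_vec_def grad_def F_def mult.commute)
    have l: "v x \<bullet> laplacian v x = L" by (simp add: laplacian_def inner_sum_right L_def)
    have b: "v x \<bullet> grad (divergence v) x = B" by (simp add: inner_vec_def grad_def B_def)
    show ?thesis
      using arg_cong[OF momentum[of x], of "\<lambda>u. v x \<bullet> u"]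
      by (simp add: lhs p f l b inner_add_right inner_diff_right)
  qed
  have "(\<Sum>j\<in>UNIV. partial j (G j) x) =
     (- (1/2)) * ((\<Sum>j\<in>UNIV. partial j \<rho> x * v x $ j + \<rho> x * partial j v x $ j) * (v x \<bullet> v x) + 2 * (\<rho> x * T))
     + (- (a * \<gamma> / (\<gamma> - 1))) * (\<gamma> * \<rho> x powr (\<gamma> - 1) * (\<Sum>j\<in>UNIV. partial j \<rho> x * v x $ j) + \<rho> x powr \<gamma> * (\<Sum>j\<in>UNIV. partial j v x $ j))
     + k * (\<rho> x * F + \<Phi> x * (\<Sum>j\<in>UNIV. partial j \<rho> x * v x $ j + \<rho> x * partial j v x $ j))
     + \<mu> * ((\<Sum>j\<in>UNIV. partial j v x \<bullet> partial j v x) + L)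
     + (\<mu> + lam) * ((\<Sum>j\<in>UNIV. partial j v x $ j) * divergence v x + B)"
    unfolding partial_G T_def F_def L_def B_def
    by (simp only: sum.distrib sum_distrib_left sum_distrib_right distrib_left distrib_right)
       (simp only: sum_distrib_left sum_distrib_right ac_simps)
  also have "\<dots> = - (\<rho> x * T) - (a * \<gamma> / (\<gamma> - 1)) * (\<gamma> * (\<rho> x powr (\<gamma> - 1) * \<rho> x) * (- d) + P * d)
     + k * \<rho> x * F + \<mu> * (J + L) + (\<mu> + lam) * (d * d + B)"
    unfolding s4 unfolding s1 s2 s3 by (simp add: P_def d_def)
  also have "(a * \<gamma> / (\<gamma> - 1)) * (\<gamma> * (\<rho> x powr (\<gamma> - 1) * \<rho> x) * (- d) + P * d) = - (a * \<gamma> * P * d)"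
  proof -
    have "\<gamma> * (\<rho> x powr (\<gamma> - 1) * \<rho> x) * (- d) + P * d = - ((\<gamma> - 1) * (P * d))"
      unfolding pow by (simp add: algebra_simps)
    then show ?thesis using \<gamma> by simp
  qed
  finally show ?thesis
    using m by (simp add: J_def d_def power2_eq_square algebra_simps)
qed

lemma continuous_basic:
  "continuous_on UNIV \<rho>" "continuous_on UNIV v" "continuous_on UNIV \<Phi>"
  "continuous_on UNIV (partial i \<rho>)" "continuous_on UNIV (partial i v)" "continuous_on UNIV (partial i \<Phi>)"
  "continuous_on UNIV (partial i (partial j v))"
  using smooth by (auto intro!: smooth_continuous smooth_partial)

lemma continuous_divergence: "continuous_on UNIV (divergence v)"
  unfolding divergence_v by (intro continuous_intros continuous_basic)

lemma continuous_partial_divergence: "continuous_on UNIV (partial j (divergence v))"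
proof -
  have "partial j (divergence v) = (\<lambda>x. \<Sum>i\<in>UNIV. partial j (partial i v) x $ i)"
    unfolding divergence_v by (rule ext) (simp add: partial_sum differentiable_component dpv partial_component)
  then show ?thesis by (simp) (intro continuous_intros continuous_basic)
qed

lemma continuous_powr_density: "s > 0 \<Longrightarrow> continuous_on UNIV (\<lambda>x. \<rho> x powr s)"
  using nonneg by (intro continuous_on_powr' continuous_basic continuous_on_const) auto

lemma continuous_G: "continuous_on UNIV (G j)"
  by (intro differentiable_imp_continuous_on) (simp add: differentiable_on_def dG)

lemma continuous_partial_G: "continuous_on UNIV (partial j (G j))"
proof -
  have [continuous_intros]: "continuous_on UNIV (\<lambda>x. \<rho> x powr (\<gamma> - 1))" "continuous_on UNIV (\<lambda>x. \<rho> x powr \<gamma>)"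
    using \<gamma> by (auto intro: continuous_powr_density)
  show ?thesis
    unfolding partial_G[abs_def]
    by (rule continuous_on_add continuous_on_mult continuous_on_inner continuous_on_component continuous_on_const
        continuous_basic continuous_divergence continuous_partial_divergence
        \<open>continuous_on UNIV (\<lambda>x. \<rho> x powr (\<gamma> - 1))\<close> \<open>continuous_on UNIV (\<lambda>x. \<rho> x powr \<gamma>)\<close>)+
qed

text \<open>The cutoff makes all integrands continuous with compact support, so the divergence of
  \<open>cutoff R\<close> times the flux integrates to \<open>0\<close>.\<close>

lemma tested_energy:
  assumes R: "R > 0"
  shows "integrable lborel (\<lambda>x. cutoff R x * (\<mu> * (norm (jacobian v (at x)))\<^sup>2 + (\<mu> + lam) * (divergence v x)\<^sup>2))"
    and "integrable lborel (\<lambda>x. \<Sum>j\<in>UNIV. partial j (cutoff R) x * G j x)"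
    and "(\<integral>x. cutoff R x * (\<mu> * (norm (jacobian v (at x)))\<^sup>2 + (\<mu> + lam) * (divergence v x)\<^sup>2) \<partial>lborel)
       = - (\<integral>x. (\<Sum>j\<in>UNIV. partial j (cutoff R) x * G j x) \<partial>lborel)"
proof -
  have o: "cutoff R x = 0" "partial j (cutoff R) x = 0" if "norm x > R" for j and x :: "real^'n"
    using cutoff_outside[OF R that] by (simp_all add: cutoff_def partial_cutoff)
  have dc: "cutoff R differentiable (at x)" for x :: "real^'n"
    using cutoff_has_derivative by (rule differentiableI)
  have i1: "integrable lborel (\<lambda>x. partial j (cutoff R) x * G j x)" for j
    using o by (intro integrable_compact_support[of _ R] continuous_intros partial_cutoff_continuous continuous_G) auto
  have i2: "integrable lborel (\<lambda>x. cutoff R x * partial j (G j) x)" for j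
    using o by (intro integrable_compact_support[of _ R] continuous_intros cutoff_continuous continuous_partial_G) auto
  have z: "(\<integral>x. cutoff R x * partial j (G j) x \<partial>lborel) = - (\<integral>x. partial j (cutoff R) x * G j x \<partial>lborel)" for j
  proof -
    have p: "partial j (\<lambda>x. cutoff R x * G j x) = (\<lambda>x. cutoff R x * partial j (G j) x + partial j (cutoff R) x * G j x)"
      by (rule ext) (intro partial_mult dc dG)
    have "(\<integral>x. partial j (\<lambda>x. cutoff R x * G j x) x \<partial>lborel) = 0"
    proof (rule integral_partial_eq_0)
      show "(\<lambda>x. cutoff R x * G j x) differentiable (at x)" for x by (intro differentiable_mult dc dG)
      show "continuous_on UNIV (partial j (\<lambda>x. cutoff R x * G j x))"
        unfolding p by (intro continuous_intros cutoff_continuous partial_cutoff_continuous continuous_G continuous_partial_G)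
      show "cutoff R x * G j x = 0" if "norm x > R" for x using o[OF that] by simp
    qed
    then show ?thesis unfolding p using i1 i2 by simp
  qed
  have e: "cutoff R x * (\<mu> * (norm (jacobian v (at x)))\<^sup>2 + (\<mu> + lam) * (divergence v x)\<^sup>2)
      = (\<Sum>j\<in>UNIV. cutoff R x * partial j (G j) x)" for x
    by (simp add: energy_identity flip: sum_distrib_left)
  show "integrable lborel (\<lambda>x. cutoff R x * (\<mu> * (norm (jacobian v (at x)))\<^sup>2 + (\<mu> + lam) * (divergence v x)\<^sup>2))"
    unfolding e using i2 by simp
  show "integrable lborel (\<lambda>x. \<Sum>j\<in>UNIV. partial j (cutoff R) x * G j x)" using i1 by simp
  show "(\<integral>x. cutoff R x * (\<mu> * (norm (jacobian v (at x)))\<^sup>2 + (\<mu> + lam) * (divergence v x)\<^sup>2) \<partial>lborel)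
       = - (\<integral>x. (\<Sum>j\<in>UNIV. partial j (cutoff R) x * G j x) \<partial>lborel)"
    unfolding e using i1 i2 z by (simp add: sum_negf)
qed

end

section \<open>Vanishing of the velocity\<close>

lemma integrable_of_nn_integral:
  assumes "f \<in> borel_measurable lborel" "\<And>x. 0 \<le> f x" "(\<integral>\<^sup>+x. ennreal (f x) \<partial>lborel) < top"
  shows "integrable lborel f"
  using assms by (intro integrableI_nonneg) auto

context smooth_flow
begin

text \<open>Only the pressure and the potential give terms linear in \<open>v\<close>; the convection term is cubic, and
  the viscous terms are split by Young's inequality.\<close>

lemma flux_bound:
  assumes n: "N = real CARD('n)" and a: "a > 0" and mu: "\<mu> > 0" "\<mu> + lam > 0"
    and bd: "\<And>x. \<rho> x \<le> P" "\<And>x. \<bar>\<Phi> x\<bar> \<le> Q"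
  defines "J \<equiv> (\<lambda>x. norm (jacobian v (at x)))"
  shows "\<bar>G j x\<bar> \<le> (a * \<gamma> / (\<gamma> - 1) * P powr \<gamma> + \<bar>k\<bar> * (Q * P)) * norm (v x)
     + (P / 2 + \<mu> + (\<mu> + lam) * N) * (norm (v x) ^ 3 + (norm (v x))\<^sup>2 + (J x)\<^sup>2)"
proof -
  have P: "0 \<le> P" using nonneg[of x] bd(1)[of x] by simp
  have Q: "0 \<le> Q" using bd(2)[of x] by simp
  have J: "0 \<le> J x" by (simp add: J_def)
  have vj: "\<bar>v x $ j\<bar> \<le> norm (v x)" by (rule component_le_norm_cart)
  have sq: "norm (v x) * J x \<le> (norm (v x))\<^sup>2 + (J x)\<^sup>2"
  proof -
    have "2 * (norm (v x) * J x) \<le> (norm (v x))\<^sup>2 + (J x)\<^sup>2"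
      using sum_squares_bound[of "norm (v x)" "J x"] by simp
    moreover have "0 \<le> norm (v x) * J x" using J by simp
    ultimately show ?thesis by linarith
  qed
  define s where "s = norm (v x) ^ 3 + (norm (v x))\<^sup>2 + (J x)\<^sup>2"
  have s: "norm (v x) ^ 3 \<le> s" "(norm (v x))\<^sup>2 + (J x)\<^sup>2 \<le> s" by (auto simp: s_def)
  have t1: "\<bar>\<rho> x * (v x \<bullet> v x) * v x $ j\<bar> \<le> P * s"
  proof -
    have "\<bar>\<rho> x * (v x \<bullet> v x) * v x $ j\<bar> \<le> P * (norm (v x))\<^sup>2 * norm (v x)"
      using nonneg[of x] bd(1)[of x] vj P unfolding abs_mult
      by (intro mult_mono) (auto simp: power2_norm_eq_inner)
    also have "\<dots> = P * norm (v x) ^ 3" by (simp add: power2_eq_square power3_eq_cube)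
    also have "\<dots> \<le> P * s" using s P by (intro mult_left_mono)
    finally show ?thesis .
  qed
  have t2: "\<bar>\<rho> x powr \<gamma> * v x $ j\<bar> \<le> P powr \<gamma> * norm (v x)"
    using nonneg[of x] bd(1)[of x] vj \<gamma> unfolding abs_mult by (intro mult_mono) (auto intro: powr_mono2)
  have t3: "\<bar>\<Phi> x * \<rho> x * v x $ j\<bar> \<le> Q * P * norm (v x)"
    using nonneg[of x] bd[of x] vj P Q unfolding abs_mult by (intro mult_mono) auto
  have t4: "\<bar>v x \<bullet> partial j v x\<bar> \<le> s"
  proof -
    have "\<bar>v x \<bullet> partial j v x\<bar> \<le> norm (v x) * J x" unfolding J_def
      by (rule order_trans[OF Cauchy_Schwarz_ineq2 mult_left_mono[OF norm_partial_le_jacobian norm_ge_zero]])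
    then show ?thesis using sq s by linarith
  qed
  have t5: "\<bar>v x $ j * divergence v x\<bar> \<le> N * s"
  proof -
    have "\<bar>divergence v x\<bar> \<le> (\<Sum>i\<in>(UNIV::'n set). J x)"
      unfolding divergence_v J_def
      by (rule order_trans[OF sum_abs sum_mono[OF order_trans[OF component_le_norm_cart norm_partial_le_jacobian]]])
    then have "\<bar>v x $ j * divergence v x\<bar> \<le> norm (v x) * (N * J x)"
      unfolding abs_mult using vj by (intro mult_mono) (auto simp: n)
    also have "\<dots> = N * (norm (v x) * J x)" by simp
    also have "\<dots> \<le> N * s" using sq s n by (intro mult_left_mono) auto
    finally show ?thesis .
  qed
  have c: "0 \<le> a * \<gamma> / (\<gamma> - 1)" using a \<gamma> by simp
  have abs_triangle: "\<bar>b1 + b2 + b3 + b4 + b5\<bar> \<le> \<bar>b1\<bar> + \<bar>b2\<bar> + \<bar>b3\<bar> + \<bar>b4\<bar> + \<bar>b5\<bar>" for b1 b2 b3 b4 b5 :: real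
    by linarith
  have "\<bar>G j x\<bar> \<le> \<bar>(- (1/2)) * (\<rho> x * (v x \<bullet> v x) * v x $ j)\<bar>
     + \<bar>(- (a * \<gamma> / (\<gamma> - 1))) * (\<rho> x powr \<gamma> * v x $ j)\<bar>
     + \<bar>k * (\<Phi> x * \<rho> x * v x $ j)\<bar>
     + \<bar>\<mu> * (v x \<bullet> partial j v x)\<bar>
     + \<bar>(\<mu> + lam) * (v x $ j * divergence v x)\<bar>"
    unfolding energy_flux_def by (intro abs_triangle)
  also have "\<dots> \<le> (1/2) * (P * s) + (a * \<gamma> / (\<gamma> - 1)) * (P powr \<gamma> * norm (v x))
     + \<bar>k\<bar> * (Q * P * norm (v x)) + \<mu> * s + (\<mu> + lam) * (N * s)"
    unfolding abs_mult[of "- (1/2)"] abs_mult[of "- (a * \<gamma> / (\<gamma> - 1))"] abs_mult[of k]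
      abs_mult[of \<mu>] abs_mult[of "\<mu> + lam"] abs_minus_cancel abs_of_nonneg[OF c]
    using c mu by (intro add_mono mult_mono t1 t2 t3 t4 t5) auto
  also have "\<dots> = (a * \<gamma> / (\<gamma> - 1) * P powr \<gamma> + \<bar>k\<bar> * (Q * P)) * norm (v x)
     + (P / 2 + \<mu> + (\<mu> + lam) * N) * s"
    by (simp add: algebra_simps)
  finally show ?thesis by (simp only: s_def)
qed

text \<open>The tested energy identity bounds the localised dissipation by \<open>1 / R\<close> times the integral of the
  bound in \<open>flux_bound\<close> over the ball, which tends to \<open>0\<close>.  To keep the integrands continuous, the
  dissipation is localised by a second cutoff of fixed radius, at most twice any cutoff of at
  least double that radius.\<close>

theorem velocity_vanishes:
  assumes n: "CARD('n) \<ge> 2" and N: "N = real CARD('n)" and a: "a > 0" and mu: "\<mu> > 0" "\<mu> + lam > 0"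
    and bd: "\<And>x. \<rho> x \<le> P" "\<And>x. \<bar>\<Phi> x\<bar> \<le> Q"
    and K: "(\<integral>\<^sup>+x. ennreal (norm (v x) powr (N / (N - 1))) \<partial>lborel) < top"
    and D: "(\<integral>\<^sup>+x. ennreal ((norm (jacobian v (at x)))\<^sup>2) \<partial>lborel) < top"
    and C: "(\<integral>\<^sup>+x. ennreal (norm (v x) ^ 3) \<partial>lborel) < top"
  shows "v x = 0"
proof -
  define q where "q = N / (N - 1)"
  have N2: "2 \<le> N" using n N by simp
  have q: "1 < q" "q \<le> 2" using N2 by (auto simp: q_def field_simps)
  define J where "J x = norm (jacobian v (at x))" for x
  have vm [measurable]: "v \<in> borel_measurable borel"
    using continuous_basic(2) by (rule borel_measurable_continuous_onI)
  have Jc: "continuous_on UNIV J"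
    unfolding J_def by (intro continuous_on_norm continuous_jacobian continuous_basic)
  then have [measurable]: "J \<in> borel_measurable borel"
    by (rule borel_measurable_continuous_onI)
  have p3: "norm (v x) powr 3 = norm (v x) ^ 3" and p2: "norm (v x) powr 2 = (norm (v x))\<^sup>2" for x
    by (simp_all add: powr_numeral)
  have "(\<integral>\<^sup>+x. ennreal (norm (v x) powr 2) \<partial>lborel) < top"
    by (rule interpolation_integrable[of _ q _ 3]) (use q K C p3 in \<open>auto simp: q_def\<close>)
  then have C2: "(\<integral>\<^sup>+x. ennreal ((norm (v x))\<^sup>2) \<partial>lborel) < top" by (simp add: p2)
  define H where "H x = norm (v x) ^ 3 + (norm (v x))\<^sup>2 + (J x)\<^sup>2" for x
  have Hi: "integrable lborel H"
    unfolding H_def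
    by (intro Bochner_Integration.integrable_add integrable_of_nn_integral C C2) (use D in \<open>auto simp: J_def[symmetric]\<close>)
  have Ki: "integrable lborel (\<lambda>x. norm (v x) powr (N / (N - 1)))"
    by (intro integrable_of_nn_integral K) auto
  define c1 where "c1 = a * \<gamma> / (\<gamma> - 1) * P powr \<gamma> + \<bar>k\<bar> * (Q * P)"
  define c2 where "c2 = P / 2 + \<mu> + (\<mu> + lam) * N"
  define E where "E x = \<mu> * (J x)\<^sup>2 + (\<mu> + lam) * (divergence v x)\<^sup>2" for x
  define r where "r m = real (Suc m)" for m
  define A where "A m = (1 / r m) * (\<integral>x. indicator (cball 0 (r m)) x * norm (v x) \<partial>lborel)" for m
  have A0: "A \<longlonglongrightarrow> 0"
    unfolding A_def[abs_def] r_def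
    using average_tendsto_0[OF n N _ _ Ki] continuous_basic(2) by (simp add: continuous_on_norm)
  have P: "0 \<le> P" using nonneg[of 0] bd(1)[of 0] by simp
  have Q: "0 \<le> Q" using bd(2)[of 0] by simp
  have c: "0 \<le> c1" "0 \<le> c2" using a \<gamma> mu P Q N2 by (auto simp: c1_def c2_def)
  have step: "(\<integral>x. cutoff (r m) x * E x \<partial>lborel) \<le> 4 * N * c1 * A m + (4 * N * c2 * (\<integral>x. H x \<partial>lborel)) * (1 / r m)" for m
  proof -
    have r: "r m > 0" by (simp add: r_def)
    have vi: "integrable lborel (\<lambda>x. indicator (cball 0 (r m)) x * norm (v x))"
      using borel_integrable_compact[of "cball 0 (r m)" "\<lambda>x. norm (v x)"] continuous_basic(2)
      by (simp add: continuous_on_norm continuous_on_subset)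
    have "(\<integral>x. cutoff (r m) x * E x \<partial>lborel) = (\<integral>x. - (\<Sum>j\<in>UNIV. partial j (cutoff (r m)) x * G j x) \<partial>lborel)"
      using tested_energy(3)[OF r] by (simp add: E_def J_def)
    also have "\<dots> \<le> (\<integral>x. 4 * N * c1 * (1 / r m) * (indicator (cball 0 (r m)) x * norm (v x)) + 4 * N * c2 * (1 / r m) * H x \<partial>lborel)"
    proof (rule integral_mono)
      show "integrable lborel (\<lambda>x. - (\<Sum>j\<in>UNIV. partial j (cutoff (r m)) x * G j x))"
        using tested_energy(2)[OF r] by (rule Bochner_Integration.integrable_minus)
      show "integrable lborel (\<lambda>x. 4 * N * c1 * (1 / r m) * (indicator (cball 0 (r m)) x * norm (v x)) + 4 * N * c2 * (1 / r m) * H x)"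
        using vi Hi by (intro Bochner_Integration.integrable_add integrable_mult_right)
      fix x :: "real^'n"
      let ?i = "indicator (cball 0 (r m)) x :: real"
      have H0: "0 \<le> H x" by (simp add: H_def)
      have t: "\<bar>partial j (cutoff (r m)) x * G j x\<bar> \<le> 4 / r m * (?i * (c1 * norm (v x)) + c2 * H x)" for j
      proof -
        have "\<bar>partial j (cutoff (r m)) x * G j x\<bar> \<le> (4 / r m * ?i) * (c1 * norm (v x) + c2 * H x)"
          unfolding abs_mult
          using partial_cutoff_bound[OF r, of j x] flux_bound[OF N a mu bd, of j x] r
          by (intro mult_mono) (auto simp: c1_def c2_def H_def J_def)
        also have "\<dots> = 4 / r m * (?i * (c1 * norm (v x)) + ?i * (c2 * H x))"
          by (simp only: distrib_left mult.assoc)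
        also have "\<dots> \<le> 4 / r m * (?i * (c1 * norm (v x)) + c2 * H x)"
          using r c H0 by (intro mult_left_mono add_left_mono) (auto simp: indicator_def)
        finally show ?thesis .
      qed
      have "- (\<Sum>j\<in>UNIV. partial j (cutoff (r m)) x * G j x) \<le> \<bar>\<Sum>j\<in>UNIV. partial j (cutoff (r m)) x * G j x\<bar>" by simp
      also have "\<dots> \<le> (\<Sum>j\<in>(UNIV::'n set). 4 / r m * (?i * (c1 * norm (v x)) + c2 * H x))"
        by (rule order_trans[OF sum_abs sum_mono[OF t]])
      also have "\<dots> = 4 * N * c1 * (1 / r m) * (?i * norm (v x)) + 4 * N * c2 * (1 / r m) * H x"
        by (simp add: N algebra_simps)
      finally show "- (\<Sum>j\<in>UNIV. partial j (cutoff (r m)) x * G j x)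
          \<le> 4 * N * c1 * (1 / r m) * (?i * norm (v x)) + 4 * N * c2 * (1 / r m) * H x" .
    qed
    also have "\<dots> = (\<integral>x. 4 * N * c1 * (1 / r m) * (indicator (cball 0 (r m)) x * norm (v x)) \<partial>lborel) + (\<integral>x. 4 * N * c2 * (1 / r m) * H x \<partial>lborel)"
      using vi Hi by (intro Bochner_Integration.integral_add integrable_mult_right)
    also have "\<dots> = 4 * N * c1 * A m + (4 * N * c2 * (\<integral>x. H x \<partial>lborel)) * (1 / r m)"
      unfolding integral_mult_right_zero A_def by (simp only: ac_simps)
    finally show ?thesis .
  qed
  have lim: "(\<lambda>m. 4 * N * c1 * A m + (4 * N * c2 * (\<integral>x. H x \<partial>lborel)) * (1 / r m)) \<longlonglongrightarrow> 0"
    unfolding r_def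
    by (intro tendsto_add_zero tendsto_mult_right_zero A0 LIMSEQ_Suc[OF lim_1_over_n])
  have J0: "J y = 0" for y
  proof -
    define R where "R = 2 * norm y + 2"
    have R: "R > 0" "norm y \<le> R / 2" by (auto simp: R_def add_nonneg_pos)
    define f where "f x = cutoff R x * (J x)\<^sup>2" for x :: "real^'n"
    have f0: "0 \<le> f x" for x by (simp add: f_def cutoff_nonneg)
    have fc: "continuous_on UNIV f"
      unfolding f_def by (intro continuous_intros cutoff_continuous Jc)
    have fi: "integrable lborel f"
      using cutoff_outside[OF R(1)] by (intro integrable_compact_support[OF fc, of R]) (auto simp: f_def cutoff_def)
    obtain m0 where m0: "2 * R \<le> real m0" using real_arch_simple by blast
    have "\<mu> / 2 * (\<integral>x. f x \<partial>lborel) \<le> 0"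
    proof (rule LIMSEQ_le_const[OF lim], intro exI allI impI)
      fix m assume "m0 \<le> m"
      then have m: "2 * R \<le> r m" "0 < r m" using m0 by (auto simp: r_def)
      have "\<mu> / 2 * (\<integral>x. f x \<partial>lborel) = (\<integral>x. \<mu> / 2 * f x \<partial>lborel)" by simp
      also have "\<dots> \<le> (\<integral>x. cutoff (r m) x * E x \<partial>lborel)"
      proof (rule integral_mono)
        show "integrable lborel (\<lambda>x. \<mu> / 2 * f x)" using fi by simp
        show "integrable lborel (\<lambda>x. cutoff (r m) x * E x)"
          using tested_energy(1)[OF m(2)] by (simp add: E_def J_def)
        fix x :: "real^'n"
        have c: "cutoff R x \<le> 2 * cutoff (r m) x"
        proof (cases "norm x > R")
          case True
          then have "cutoff R x = 0" using cutoff_outside[OF R(1) True] by (simp add: cutoff_def)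
          then show ?thesis using cutoff_nonneg[of "r m" x] by simp
        next
          case False
          then have "1 / 2 \<le> cutoff (r m) x" using m by (intro cutoff_lower) auto
          moreover have "cutoff R x \<le> 1" unfolding cutoff_def by (intro power_le_one) auto
          ultimately show ?thesis by simp
        qed
        have "\<mu> / 2 * f x \<le> \<mu> / 2 * ((2 * cutoff (r m) x) * (J x)\<^sup>2)"
          unfolding f_def using c mu by (intro mult_left_mono mult_right_mono) auto
        also have "\<dots> = cutoff (r m) x * (\<mu> * (J x)\<^sup>2)" by simp
        also have "\<dots> \<le> cutoff (r m) x * E x"
          unfolding E_def using mu cutoff_nonneg by (intro mult_left_mono) auto
        finally show "\<mu> / 2 * f x \<le> cutoff (r m) x * E x" .
      qed
      also note step[of m]
      finally show "\<mu> / 2 * (\<integral>x. f x \<partial>lborel) \<le> 4 * N * c1 * A m + (4 * N * c2 * (\<integral>x. H x \<partial>lborel)) * (1 / r m)" .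
    qed
    then have "(\<integral>x. f x \<partial>lborel) \<le> 0" using mu by (simp add: mult_le_0_iff)
    moreover have "0 \<le> (\<integral>x. f x \<partial>lborel)" using f0 by (intro integral_nonneg_AE) auto
    ultimately have "(\<integral>x. f x \<partial>lborel) = 0" by simp
    then have "AE x in lborel. f x = 0"
      using integral_nonneg_eq_0_iff_AE[OF fi] f0 by simp
    then have "AE x in lebesgue. f x \<le> 0" by (intro AE_completion) auto
    then have "f y \<le> 0" by (rule AE_le_imp_le[OF fc])
    moreover have "1 / 2 * (J y)\<^sup>2 \<le> f y"
      unfolding f_def using cutoff_lower[OF R] by (intro mult_right_mono) auto
    ultimately have "(J y)\<^sup>2 \<le> 0" by linarith
    then show ?thesis by simp
  qed
  have "partial i v y = 0" for i y
    using norm_partial_le_jacobian[of i v y] J0[of y] by (simp add: J_def)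
  from constant_of_partials_0[OF dv this] obtain w where w: "\<And>x. v x = w" by blast
  have "w = 0"
  proof (rule ccontr)
    assume "w \<noteq> 0"
    then have "(\<integral>\<^sup>+x. ennreal (norm (v x) powr (N / (N - 1))) \<partial>lborel) = top"
      by (simp add: w ennreal_mult_top)
    with K show False by simp
  qed
  then show ?thesis by (simp add: w)
qed

end

section \<open>The stationary systems\<close>

lemma Lq_norm_finiteD:
  assumes "Lq_norm q f < top"
  shows "(\<integral>\<^sup>+x. ennreal (norm (f x) powr q) \<partial>lborel) < top"
proof (rule ccontr)
  assume "\<not> ?thesis"
  then have "(\<integral>\<^sup>+x. ennreal (norm (f x) powr q) \<partial>lebesgue) = top"
    by (simp add: nn_integral_completion not_less top_unique)
  then show False using assms by (simp add: Lq_norm_def)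
qed

lemma Linf_norm_finiteD:
  fixes f :: "'a::euclidean_space \<Rightarrow> real"
  assumes fin: "Linf_norm f < top" and c: "continuous_on UNIV f"
  obtains M where "\<And>x. \<bar>f x\<bar> \<le> M"
proof -
  obtain M where M: "Linf_norm f = ennreal M" "0 \<le> M" using fin by (cases "Linf_norm f") auto
  have "AE x in lebesgue. ennreal (norm (f x)) \<le> Linf_norm f"
    unfolding Linf_norm_def by (rule esssup_AE)
  then have "AE x in lebesgue. \<bar>f x\<bar> \<le> M" using M by simp
  then have "\<bar>f x\<bar> \<le> M" for x
    by (intro AE_le_imp_le[of "\<lambda>x. \<bar>f x\<bar>"]) (auto intro!: continuous_intros c)
  then show ?thesis using that by blast
qed

lemma cube_integrable:
  fixes v :: "real^'n::finite \<Rightarrow> real^'n"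
  assumes n: "CARD('n) \<ge> 2" and N: "N = real CARD('n)" and v: "smooth v"
    and K: "Lq_norm (N / (N - 1)) v < top" and D: "Lq_norm 2 (\<lambda>x. jacobian v (at x)) < top"
    and high: "N \<ge> 7 \<longrightarrow> v \<in> Lq_space (3 * N / (N - 1))"
  shows "(\<integral>\<^sup>+x. ennreal (norm (v x) ^ 3) \<partial>lborel) < top"
proof (cases "CARD('n) \<le> 6")
  case True
  have "(\<integral>\<^sup>+x. ennreal ((norm (jacobian v (at x)))\<^sup>2) \<partial>lborel) < top"
    using Lq_norm_finiteD[OF D] by (simp add: powr_numeral)
  then show ?thesis
    by (rule cube_integrable_low_dimension[OF n True N smooth_differentiable[OF v]
          smooth_continuous[OF smooth_partial[OF v]] Lq_norm_finiteD[OF K]])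
next
  case False
  then have N7: "N \<ge> 7" using N by simp
  then have h: "(\<integral>\<^sup>+x. ennreal (norm (v x) powr (3 * N / (N - 1))) \<partial>lborel) < top"
    using high by (intro Lq_norm_finiteD) (auto simp: Lq_space_def)
  have [measurable]: "v \<in> borel_measurable borel"
    using smooth_continuous[OF v] by (rule borel_measurable_continuous_onI)
  have e: "N / (N - 1) \<le> 3" "3 \<le> 3 * N / (N - 1)"
    using N7 by (simp_all add: field_simps)
  have "(\<integral>\<^sup>+x. ennreal (norm (v x) powr 3) \<partial>lborel) < top"
    by (rule interpolation_integrable[OF _ _ e Lq_norm_finiteD[OF K] h]) auto
  then show ?thesis by (simp add: powr_numeral)
qed

text \<open>For \<open>v = 0\<close> all other terms of the momentum equation vanish.\<close>

lemma (in smooth_flow) static_balance: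
  assumes "\<And>x. v x = 0"
  shows "(k * \<rho> x) *\<^sub>R grad \<Phi> x = a *\<^sub>R grad (\<lambda>y. \<rho> y powr \<gamma>) x"
proof -
  have v: "v = (\<lambda>_. 0)" using assms by auto
  have "div_flux \<rho> v x = 0" "laplacian v x = 0" "divergence v = (\<lambda>_. 0)"
    by (simp_all add: v div_flux_def laplacian_def divergence_def[abs_def] vec_eq_iff)
  moreover have "grad (\<lambda>_. 0) x = 0" by (simp add: grad_def vec_eq_iff)
  moreover have "grad (pressure a \<gamma> \<rho>) x = a *\<^sub>R grad (\<lambda>y. \<rho> y powr \<gamma>) x"
    unfolding pressure_def[abs_def] by (simp add: grad_def vec_eq_iff partial_cmult dpow)
  ultimately show ?thesis using momentum[of x] by simp
qed

theorem theorem1p1: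
  fixes a \<gamma> \<rho>\<^sub>0 k \<mu> lam N :: real
  assumes "CARD('n::finite) \<ge> 2" and N: "N = real CARD('n)"
    and "a > 0" and "\<gamma> > 1" and "\<rho>\<^sub>0 \<ge> 0" and "\<mu> > 0" and "lam + \<mu> > 0"
  shows
    "(k \<noteq> 0 \<longrightarrow>
       (\<forall>(\<rho> :: real^'n \<Rightarrow> real) v \<Phi>.
          smooth_NSP_solution a \<gamma> \<rho>\<^sub>0 k \<mu> lam \<rho> v \<Phi> \<and>
          Linf_norm \<rho> + Linf_norm \<Phi> + Lq_norm 2 (\<lambda>x. jacobian v (at x))
            + Lq_norm (N / (N - 1)) v < \<infinity> \<and>
          (N \<ge> 7 \<longrightarrow> v \<in> Lq_space (3 * N / (N - 1)))
          \<longrightarrow> (\<forall>x. v x = 0) \<and>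
              (\<forall>x. \<rho> x *\<^sub>R grad \<Phi> x = (a / k) *\<^sub>R grad (\<lambda>y. \<rho> y powr \<gamma>) x) \<and>
              (\<forall>x. laplacian \<Phi> x = \<rho> x - \<rho>\<^sub>0)))
     \<and>
     (\<forall>(\<rho> :: real^'n \<Rightarrow> real) v.
        smooth_NS_solution a \<gamma> \<mu> lam \<rho> v \<and>
        Linf_norm \<rho> + Lq_norm 2 (\<lambda>x. jacobian v (at x)) + Lq_norm (N / (N - 1)) v < \<infinity> \<and>
        (N \<ge> 7 \<longrightarrow> v \<in> Lq_space (3 * N / (N - 1)))
        \<longrightarrow> (\<forall>x. v x = 0) \<and> (\<exists>c. \<forall>x. \<rho> x = c))"
proof (intro conjI impI allI)
  have vanish: "v x = 0"
    if flow: "smooth_flow a \<gamma> k \<mu> lam \<rho> v \<Phi>" and fin: "Linf_norm \<rho> < top" "Linf_norm \<Phi> < top"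
      "Lq_norm 2 (\<lambda>x. jacobian v (at x)) < top" "Lq_norm (N / (N - 1)) v < top"
      and high: "N \<ge> 7 \<longrightarrow> v \<in> Lq_space (3 * N / (N - 1))"
    for k and \<rho> :: "real^'n \<Rightarrow> real" and v \<Phi> x
  proof -
    interpret smooth_flow a \<gamma> k \<mu> lam \<rho> v \<Phi> by (rule flow)
    obtain P where P: "\<And>x. \<bar>\<rho> x\<bar> \<le> P"
      using Linf_norm_finiteD[OF fin(1) continuous_basic(1)] by blast
    obtain Q where Q: "\<And>x. \<bar>\<Phi> x\<bar> \<le> Q"
      using Linf_norm_finiteD[OF fin(2) continuous_basic(3)] by blast
    show ?thesis
    proof (rule velocity_vanishes[OF assms(1) N])
      show "\<rho> x \<le> P" for x using P[of x] by simp
      show "(\<integral>\<^sup>+x. ennreal ((norm (jacobian v (at x)))\<^sup>2) \<partial>lborel) < top"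
        using Lq_norm_finiteD[OF fin(3)] by (simp add: powr_numeral)
    qed (use assms Q Lq_norm_finiteD[OF fin(4)] cube_integrable[OF assms(1) N smooth(2) fin(4,3) high] in auto)
  qed
  {
    fix \<rho> :: "real^'n \<Rightarrow> real" and v \<Phi>
    assume k: "k \<noteq> 0"
    assume A: "smooth_NSP_solution a \<gamma> \<rho>\<^sub>0 k \<mu> lam \<rho> v \<Phi> \<and>
          Linf_norm \<rho> + Linf_norm \<Phi> + Lq_norm 2 (\<lambda>x. jacobian v (at x))
            + Lq_norm (N / (N - 1)) v < \<infinity> \<and>
          (N \<ge> 7 \<longrightarrow> v \<in> Lq_space (3 * N / (N - 1)))"
    then interpret smooth_flow a \<gamma> k \<mu> lam \<rho> v \<Phi>
      using assms by unfold_locales (auto simp: smooth_NSP_solution_def)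
    show v: "v x = 0" for x
      using A by (intro vanish[OF smooth_flow_axioms]) auto
    show "\<rho> x *\<^sub>R grad \<Phi> x = (a / k) *\<^sub>R grad (\<lambda>y. \<rho> y powr \<gamma>) x" for x
    proof -
      have "\<rho> x *\<^sub>R grad \<Phi> x = (1 / k) *\<^sub>R ((k * \<rho> x) *\<^sub>R grad \<Phi> x)" using k by simp
      also have "\<dots> = (a / k) *\<^sub>R grad (\<lambda>y. \<rho> y powr \<gamma>) x" by (simp add: static_balance[OF v])
      finally show ?thesis .
    qed
    show "laplacian \<Phi> x = \<rho> x - \<rho>\<^sub>0" for x
      using A by (auto simp: smooth_NSP_solution_def)
  }
  {
    fix \<rho> :: "real^'n \<Rightarrow> real" and v
    assume A: "smooth_NS_solution a \<gamma> \<mu> lam \<rho> v \<and>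
        Linf_norm \<rho> + Lq_norm 2 (\<lambda>x. jacobian v (at x)) + Lq_norm (N / (N - 1)) v < \<infinity> \<and>
        (N \<ge> 7 \<longrightarrow> v \<in> Lq_space (3 * N / (N - 1)))"
    then interpret smooth_flow a \<gamma> 0 \<mu> lam \<rho> v "\<lambda>_. 0"
      using assms by unfold_locales (auto simp: smooth_NS_solution_def smooth_const)
    have "Linf_norm (\<lambda>_::real^'n. 0::real) \<le> 0"
      unfolding Linf_norm_def by (intro esssup_I) auto
    then show v: "v x = 0" for x
      using A by (intro vanish[OF smooth_flow_axioms]) auto
    have "partial i (\<lambda>y. \<rho> y powr \<gamma>) x = 0" for i x
    proof -
      have "a *\<^sub>R grad (\<lambda>y. \<rho> y powr \<gamma>) x = 0" using static_balance[OF v, of x] by simp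
      then show ?thesis using assms(3) by (simp add: grad_def vec_eq_iff)
    qed
    from constant_of_partials_0[OF dpow this] obtain c where c: "\<And>x. \<rho> x powr \<gamma> = c" by blast
    have "\<rho> x = c powr (1 / \<gamma>)" for x
      using nonneg[of x] assms(4) by (simp add: c[of x, symmetric] powr_powr)
    then show "\<exists>c. \<forall>x. \<rho> x = c" by blast
  }
qed

end
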